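(* Let $\lambda\neq0$ be real and $A=a_1X+b_1H+c_1Y\in sl(2,\mathbb R)$. Set $s=q-\frac x2$ and $\partial_s=\partial_q-2\partial_x$. Then for every compactly supported smooth function $f=f(x,q)\in C_c^\infty(\mathbb R^2)$, the operator $\hat l_A=\mathcal F_p\circ l_A\circ\mathcal F_p^{-1}$ is given by $$\hat l_A(f)=(a_1\cos s+b_1\sin s-c_1)\,\partial_sf+(-a_1\sin s+b_1\cos s)(2\lambda i+1)\,f .$$
   Context: $H=\begin{pmatrix}1&0\\0&-1\end{pmatrix}$, $X=\begin{pmatrix}0&1\\1&0\end{pmatrix}$, $Y=\begin{pmatrix}0&1\\-1&0\end{pmatrix}$ is a basis of $sl(2,\mathbb R)$ with dual basis $H^*,X^*,Y^*$. The coadjoint orbit $\Omega^1_\lambda=\{2xX^*+2hH^*-2yY^*\mid x^2+h^2=y^2+\lambda^2\}$ is parametrized by $(p,q)\in\mathbb R^2$ via $x=p\cos q-\lambda\sin q$, $h=p\sin q+\lambda\cos q$, $y=p$, and in these coordinates the function $\tilde A:F\mapsto\langle F,A\rangle$ is $\tilde A(p,q)=(2a_1\cos q+2b_1\sin q-2c_1)p+(-2a_1\sin q+2b_1\cos q)\lambda$. The operator $l_A$ is left Moyal multiplication by $i\tilde A$: $l_A(g)=i\tilde A\star g=i\sum_{k=0}^\infty\frac1{k!}\big(\frac1{2i}\big)^kP^k(\tilde A,g)$, where $P^k(u,v)=\sum\Lambda^{i_1j_1}\cdots\Lambda^{i_kj_k}\partial_{i_1\cdots i_k}u\,\partial_{j_1\cdots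 j_k}v$, summed over all indices in $\{1,2\}$, with $\partial_1=\partial_p$, $\partial_2=\partial_q$, $\Lambda^{12}=1$, $\Lambda^{21}=-1$, $\Lambda^{11}=\Lambda^{22}=0$. $\mathcal F_p$ is the partial Fourier transform in the variable $p$, $\mathcal F_p(g)(x,q)=\frac1{\sqrt{2\pi}}\int_{\mathbb R}e^{-ipx}g(p,q)\,dp$, where now $x$ is the variable dual to $p$ (not the orbit coordinate), and $\mathcal F_p^{-1}$ is its inverse. *)

theory Defs
  imports "HOL-Analysis.Analysis"
begin

section \<open>The Lie algebra \<open>sl(2,R)\<close> and its coadjoint orbits\<close>

definition sl2 :: "(real^2^2) set" where
  "sl2 = {A. trace A = 0}"

definition sl2_H :: "real^2^2" where
  "sl2_H = vector [vector [1, 0], vector [0, -1]]"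

definition sl2_X :: "real^2^2" where
  "sl2_X = vector [vector [0, 1], vector [1, 0]]"

definition sl2_Y :: "real^2^2" where
  "sl2_Y = vector [vector [0, 1], vector [-1, 0]]"

text \<open>The dual basis consists of the coefficient functionals of the basis \<open>H, X, Y\<close>. They are
  total functions on matrices (zero off \<open>sl2\<close>); only their values on \<open>sl2\<close> matter. The pairing
  \<open>\<langle>F, A\<rangle>\<close> is the application \<open>F A\<close>.\<close>

definition dual_H :: "real^2^2 \<Rightarrow> real" where
  "dual_H A = representation {sl2_H, sl2_X, sl2_Y} A sl2_H"

definition dual_X :: "real^2^2 \<Rightarrow> real" where
  "dual_X A = representation {sl2_H, sl2_X, sl2_Y} A sl2_X"

definition dual_Y :: "real^2^2 \<Rightarrow> real" where
  "dual_Y A = representation {sl2_H, sl2_X, sl2_Y} A sl2_Y"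

definition orbit_functional :: "real \<Rightarrow> real \<Rightarrow> real \<Rightarrow> real^2^2 \<Rightarrow> real" where
  "orbit_functional x h y = (\<lambda>A. 2 * x * dual_X A + 2 * h * dual_H A - 2 * y * dual_Y A)"

definition coadjoint_orbit :: "real \<Rightarrow> (real^2^2 \<Rightarrow> real) set" where
  "coadjoint_orbit lam = {orbit_functional x h y | x h y. x\<^sup>2 + h\<^sup>2 = y\<^sup>2 + lam\<^sup>2}"

definition orbit_param :: "real \<Rightarrow> real \<times> real \<Rightarrow> real^2^2 \<Rightarrow> real" where
  "orbit_param lam = (\<lambda>(p, q).
     orbit_functional (p * cos q - lam * sin q) (p * sin q + lam * cos q) p)"

definition tilde :: "real \<Rightarrow> real^2^2 \<Rightarrow> real \<times> real \<Rightarrow> real" where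
  "tilde lam A z = orbit_param lam z A"

lemma sl2_decomp:
  assumes "A \<in> sl2"
  shows "A = ((A$1$2 + A$2$1) / 2) *\<^sub>R sl2_X + A$1$1 *\<^sub>R sl2_H + ((A$1$2 - A$2$1) / 2) *\<^sub>R sl2_Y"
  using assms
  by (simp add: sl2_def trace_def vec_eq_iff forall_2 sum_2 sl2_X_def sl2_H_def sl2_Y_def field_simps)

lemma sl2_lincomb_mem: "a *\<^sub>R sl2_X + b *\<^sub>R sl2_H + c *\<^sub>R sl2_Y \<in> sl2"
  by (simp add: sl2_def trace_def sum_2 sl2_X_def sl2_H_def sl2_Y_def)

lemma sl2_basis_distinct: "sl2_H \<noteq> sl2_X" "sl2_H \<noteq> sl2_Y" "sl2_X \<noteq> sl2_Y"
  by (simp_all add: vec_eq_iff forall_2 sl2_X_def sl2_H_def sl2_Y_def)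

lemma sl2_independent: "independent {sl2_H, sl2_X, sl2_Y}"
proof (rule independent_if_scalars_zero)
  show "finite {sl2_H, sl2_X, sl2_Y}" by simp
next
  fix f :: "real^2^2 \<Rightarrow> real" and B
  assume s: "(\<Sum>B\<in>{sl2_H, sl2_X, sl2_Y}. f B *\<^sub>R B) = 0" and B: "B \<in> {sl2_H, sl2_X, sl2_Y}"
  have "f sl2_H *\<^sub>R sl2_H + (f sl2_X *\<^sub>R sl2_X + f sl2_Y *\<^sub>R sl2_Y) = 0"
    using s sl2_basis_distinct by simp
  then have e: "f sl2_H *\<^sub>R sl2_H $ i $ j + (f sl2_X *\<^sub>R sl2_X $ i $ j + f sl2_Y *\<^sub>R sl2_Y $ i $ j) = 0"
    for i j by (simp add: vec_eq_iff)
  have "f sl2_H = 0" "f sl2_X + f sl2_Y = 0" "f sl2_X - f sl2_Y = 0"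
    using e[of 1 1] e[of 1 2] e[of 2 1] by (simp_all add: sl2_X_def sl2_H_def sl2_Y_def)
  then show "f B = 0" using B by auto
qed

lemma sl2_span: "span {sl2_H, sl2_X, sl2_Y} = sl2"
proof
  have "subspace sl2"
    by (simp add: subspace_def sl2_def trace_def sum_2 algebra_simps)
      (metis add.right_neutral distrib_left mult_zero_right)
  moreover have "{sl2_H, sl2_X, sl2_Y} \<subseteq> sl2"
    by (simp add: sl2_def trace_def sum_2 sl2_X_def sl2_H_def sl2_Y_def)
  ultimately show "span {sl2_H, sl2_X, sl2_Y} \<subseteq> sl2" by (rule span_minimal[rotated])
  show "sl2 \<subseteq> span {sl2_H, sl2_X, sl2_Y}"
  proof
    fix A assume "A \<in> sl2"
    from sl2_decomp[OF this] show "A \<in> span {sl2_H, sl2_X, sl2_Y}"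
      by (metis (no_types, lifting) span_add span_base span_scale insertI1 insertI2)
  qed
qed

lemma dual_lincomb:
  defines "A \<equiv> \<lambda>a b c. a *\<^sub>R sl2_X + b *\<^sub>R sl2_H + c *\<^sub>R sl2_Y"
  shows "dual_X (A a b c) = a" "dual_H (A a b c) = b" "dual_Y (A a b c) = c"
proof -
  let ?B = "{sl2_H, sl2_X, sl2_Y}"
  have m: "B \<in> ?B \<Longrightarrow> B \<in> span ?B" for B by (rule span_base)
  have "representation ?B (A a b c) =
      (\<lambda>B. a * representation ?B sl2_X B + b * representation ?B sl2_H B + c * representation ?B sl2_Y B)"
    unfolding A_def using sl2_independent m
    by (simp add: real_vector.representation_add real_vector.representation_scale span_add span_scale
        fun_eq_iff)
  then show "dual_X (A a b c) = a" "dual_H (A a b c) = b" "dual_Y (A a b c) = c"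
    using sl2_basis_distinct sl2_independent
    by (simp_all add: dual_X_def dual_H_def dual_Y_def real_vector.representation_basis)
qed

lemma tilde_lincomb:
  "tilde lam (a *\<^sub>R sl2_X + b *\<^sub>R sl2_H + c *\<^sub>R sl2_Y) (p, q) =
     (2 * a * cos q + 2 * b * sin q - 2 * c) * p + (- 2 * a * sin q + 2 * b * cos q) * lam"
  unfolding tilde_def orbit_param_def orbit_functional_def prod.case dual_lincomb
  by (simp add: algebra_simps)

lemma range_orbit_param:
  assumes "lam \<noteq> 0"
  shows "range (orbit_param lam) = coadjoint_orbit lam"
proof
  have "(p * cos q - lam * sin q)\<^sup>2 + (p * sin q + lam * cos q)\<^sup>2 = p\<^sup>2 + lam\<^sup>2" for p q
  proof -
    have "(p * cos q - lam * sin q)\<^sup>2 + (p * sin q + lam * cos q)\<^sup>2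
        = (p\<^sup>2 + lam\<^sup>2) * ((sin q)\<^sup>2 + (cos q)\<^sup>2)" by algebra
    then show ?thesis by simp
  qed
  then show "range (orbit_param lam) \<subseteq> coadjoint_orbit lam"
    by (fastforce simp: orbit_param_def coadjoint_orbit_def)
  show "coadjoint_orbit lam \<subseteq> range (orbit_param lam)"
  proof
    fix F assume "F \<in> coadjoint_orbit lam"
    then obtain x h y where F: "F = orbit_functional x h y" and e: "x\<^sup>2 + h\<^sup>2 = y\<^sup>2 + lam\<^sup>2"
      by (auto simp: coadjoint_orbit_def)
    define z where "z = Complex y lam"
    define w where "w = Complex x h"
    have "z \<noteq> 0" using assms by (simp add: z_def complex_eq_iff)
    moreover have "norm w = norm z" using e by (simp add: w_def z_def cmod_def)
    ultimately have "norm (w / z) = 1" by (simp add: norm_divide)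
    then obtain q where "w / z = exp (\<i> * of_real q)" by (metis complex_norm_eq_1_exp)
    then have "w = z * cis q" using \<open>z \<noteq> 0\<close> by (simp add: cis_conv_exp field_simps)
    then have "x = y * cos q - lam * sin q" "h = y * sin q + lam * cos q"
      by (simp_all add: w_def z_def complex_eq_iff)
    then have "F = orbit_param lam (y, q)" by (simp add: F orbit_param_def)
    then show "F \<in> range (orbit_param lam)" by blast
  qed
qed

section \<open>Partial derivatives and smooth functions on the plane\<close>

text \<open>Indices are \<open>1\<close> and \<open>2\<close>; \<open>partial i\<close> differentiates with respect to the \<open>i\<close>-th component of
  the pair, whatever that component is called: for functions of \<open>(p, q)\<close> they are
  \<open>\<partial>\<^sub>p\<close>, \<open>\<partial>\<^sub>q\<close>, for functions of \<open>(x, q)\<close> they are \<open>\<partial>\<^sub>x\<close>, \<open>\<partial>\<^sub>q\<close>.\<close>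

definition axis_dir :: "nat \<Rightarrow> real \<times> real" where
  "axis_dir i = (if i = 1 then (1, 0) else (0, 1))"

definition partial :: "nat \<Rightarrow> (real \<times> real \<Rightarrow> complex) \<Rightarrow> real \<times> real \<Rightarrow> complex" where
  "partial i u z = vector_derivative (\<lambda>t. u (z + t *\<^sub>R axis_dir i)) (at 0)"

definition partials :: "nat list \<Rightarrow> (real \<times> real \<Rightarrow> complex) \<Rightarrow> real \<times> real \<Rightarrow> complex" where
  "partials is u = foldr partial is u"

definition smooth :: "(real \<times> real \<Rightarrow> complex) \<Rightarrow> bool" where
  "smooth u \<longleftrightarrow> (\<forall>is. set is \<subseteq> {1, 2} \<longrightarrow>
     continuous_on UNIV (partials is u) \<and>
     (\<forall>i\<in>{1, 2}. \<forall>z. (\<lambda>t. partials is u (z + t *\<^sub>R axis_dir i)) differentiable (at 0)))"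

definition Cc_infinity :: "(real \<times> real \<Rightarrow> complex) set" where
  "Cc_infinity = {u. smooth u \<and> compact (closure {z. u z \<noteq> 0})}"

section \<open>The Moyal product and the operator \<open>l\<^sub>A\<close>\<close>

definition Lambda :: "nat \<Rightarrow> nat \<Rightarrow> complex" where
  "Lambda i j = (if i = 1 \<and> j = 2 then 1 else if i = 2 \<and> j = 1 then -1 else 0)"

definition multi_indices :: "nat \<Rightarrow> nat list set" where
  "multi_indices k = {is. set is \<subseteq> {1, 2} \<and> length is = k}"

definition P_pow :: "nat \<Rightarrow> (real \<times> real \<Rightarrow> complex) \<Rightarrow> (real \<times> real \<Rightarrow> complex) \<Rightarrow> real \<times> real \<Rightarrow> complex"
  where
  "P_pow k u v z = (\<Sum>is\<in>multi_indices k. \<Sum>js\<in>multi_indices k.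
     (\<Prod>m<k. Lambda (is ! m) (js ! m)) * partials is u z * partials js v z)"

definition moyal_term ::
  "(real \<times> real \<Rightarrow> complex) \<Rightarrow> (real \<times> real \<Rightarrow> complex) \<Rightarrow> real \<times> real \<Rightarrow> nat \<Rightarrow> complex" where
  "moyal_term u v z k = (1 / fact k) * (1 / (2 * \<i>)) ^ k * P_pow k u v z"

definition l_op :: "real \<Rightarrow> real^2^2 \<Rightarrow> (real \<times> real \<Rightarrow> complex) \<Rightarrow> real \<times> real \<Rightarrow> complex" where
  "l_op lam A g z = \<i> * (\<Sum>k. moyal_term (\<lambda>w. complex_of_real (tilde lam A w)) g z k)"

text \<open>Both \<open>suminf\<close> and the Lebesgue integral are total in HOL, so the functions to which the
  operators genuinely apply are recorded as domains.\<close>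

definition l_dom :: "real \<Rightarrow> real^2^2 \<Rightarrow> (real \<times> real \<Rightarrow> complex) set" where
  "l_dom lam A = {g. smooth g \<and>
     (\<forall>z. summable (moyal_term (\<lambda>w. complex_of_real (tilde lam A w)) g z))}"

section \<open>The partial Fourier transform in the first variable\<close>

definition fourier_dom :: "(real \<times> real \<Rightarrow> complex) set" where
  "fourier_dom = {g. \<forall>q. integrable lborel (\<lambda>p. g (p, q))}"

definition fourier_p :: "(real \<times> real \<Rightarrow> complex) \<Rightarrow> real \<times> real \<Rightarrow> complex" where
  "fourier_p g = (\<lambda>(x, q). complex_of_real (1 / sqrt (2 * pi)) *
     (LINT p|lborel. exp (- \<i> * of_real (p * x)) * g (p, q)))"

definition fourier_p_inv :: "(real \<times> real \<Rightarrow> complex) \<Rightarrow> real \<times> real \<Rightarrow> complex" where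
  "fourier_p_inv f = (\<lambda>(p, q). complex_of_real (1 / sqrt (2 * pi)) *
     (LINT x|lborel. exp (\<i> * of_real (p * x)) * f (x, q)))"

definition l_hat :: "real \<Rightarrow> real^2^2 \<Rightarrow> (real \<times> real \<Rightarrow> complex) \<Rightarrow> real \<times> real \<Rightarrow> complex" where
  "l_hat lam A = fourier_p \<circ> l_op lam A \<circ> fourier_p_inv"

definition partial_s :: "(real \<times> real \<Rightarrow> complex) \<Rightarrow> real \<times> real \<Rightarrow> complex" where
  "partial_s f z = partial 2 f z - 2 * partial 1 f z"

end

theory Submission
  imports Defs "HOL-Probability.Sinc_Integral" "HOL-Probability.Characteristic_Functions"
begin

text \<open>
  Write \<open>G = fourier_p_inv\<close> and \<open>s = q - x / 2\<close>. The symbol of \<open>A\<close> is affine in \<open>p\<close>: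
  it is \<open>\<alpha>(q) p + \<beta>(q)\<close> with \<open>\<alpha>\<close>, \<open>\<beta>\<close> trigonometric polynomials of degree one. In
  \<open>P\<^sup>k\<close> at most one derivative can therefore be a \<open>\<partial>\<^sub>p\<close> of the symbol, and only two kinds of summands
  survive: \<open>(-1)\<^sup>k (\<alpha>\<^sup>(\<^sup>k\<^sup>) p + \<beta>\<^sup>(\<^sup>k\<^sup>)) \<partial>\<^sub>p\<^sup>k g\<close>, and \<open>k\<close> equal copies of
  \<open>(-1)\<^sup>k\<^sup>-\<^sup>1 \<alpha>\<^sup>(\<^sup>k\<^sup>-\<^sup>1\<^sup>) \<partial>\<^sub>p\<^sup>k\<^sup>-\<^sup>1 \<partial>\<^sub>q g\<close> (lemma \<open>P_pow_fourier_p_inv_affine\<close>).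

  For \<open>g = G f\<close> each \<open>\<partial>\<^sub>p\<close> is multiplication of \<open>f\<close> by \<open>i x\<close>. Together with the factors
  \<open>1 / (2 i)\<close> this turns the Moyal series into the Taylor series of \<open>\<alpha>\<close> and \<open>\<beta>\<close> at \<open>q\<close> with
  increment \<open>- x / 2\<close>, under the Fourier integral; since \<open>f\<close> is supported in a bounded range of
  \<open>x\<close>, sum and integral may be interchanged. The result (lemma \<open>moyal_fourier_p_inv_sums\<close>) is
  \<open>p G(\<alpha>(s) f) + G(\<beta>(s) f) + G(\<alpha>(s) \<partial>\<^sub>q f) / (2 i)\<close>. Multiplying by \<open>i\<close> and integrating by parts,
  \<open>i p G(w) = - G(\<partial>\<^sub>x w)\<close>, expresses \<open>l_op\<close> applied to \<open>G f\<close> as \<open>G h\<close> with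
  \<open>h = \<alpha>(s) (\<partial>\<^sub>q - 2 \<partial>\<^sub>x) f / 2 + (\<alpha>'(s) / 2 + i \<beta>(s)) f\<close>,
  which is the right-hand side of the theorem. The summand \<open>1\<close> next to \<open>2 \<lambda> i\<close> is the
  contribution of \<open>\<alpha>'(s) / 2\<close>, produced when \<open>\<partial>\<^sub>x\<close> hits \<open>\<alpha>(q - x / 2)\<close>.

  It remains to undo \<open>G\<close>. Both \<open>f\<close> and \<open>h\<close> are smooth with support in a strip
  \<open>\<bar>x\<bar> \<le> R\<close>; two integrations by parts show that \<open>G\<close> of such a function decays like
  \<open>1 / (1 + p\<^sup>2)\<close>, and Fourier inversion applies on every line \<open>q = const\<close>. Inversion is proved by
  Gaussian regularization from the characteristic function of the normal distribution.
\<close>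

section \<open>Calculus of smooth functions on the plane\<close>

text \<open>Translation of the parameter turns differentiability at \<open>0\<close> along an axis, in which \<open>partial\<close>
  and \<open>smooth\<close> are phrased, into ordinary one-variable differentiability at every point of a
  coordinate line.\<close>

lemma slice_has_partial_iff:
  "((\<lambda>t. u ((x, q) + t *\<^sub>R axis_dir 1)) has_vector_derivative d) (at 0) \<longleftrightarrow>
     ((\<lambda>x. u (x, q)) has_vector_derivative d) (at x)"
  "((\<lambda>t. u ((x, q) + t *\<^sub>R axis_dir 2)) has_vector_derivative d) (at 0) \<longleftrightarrow>
     ((\<lambda>q. u (x, q)) has_vector_derivative d) (at q)"
proof -
  have shift: "((\<lambda>t. g (a + t)) has_vector_derivative d) (at 0) \<longleftrightarrow> (g has_vector_derivative d) (at a)"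
    for g :: "real \<Rightarrow> 'a" and a
    by (simp add: has_vector_derivative_def has_derivative_at add.commute)
  show "((\<lambda>t. u ((x, q) + t *\<^sub>R axis_dir 1)) has_vector_derivative d) (at 0) \<longleftrightarrow>
     ((\<lambda>x. u (x, q)) has_vector_derivative d) (at x)"
    using shift[of "\<lambda>x. u (x, q)" x] by (simp add: axis_dir_def)
  show "((\<lambda>t. u ((x, q) + t *\<^sub>R axis_dir 2)) has_vector_derivative d) (at 0) \<longleftrightarrow>
     ((\<lambda>q. u (x, q)) has_vector_derivative d) (at q)"
    using shift[of "\<lambda>q. u (x, q)" q] by (simp add: axis_dir_def)
qed

lemma partial_1_eqI:
  assumes "\<And>x q. ((\<lambda>x. u (x, q)) has_vector_derivative D (x, q)) (at x)"
  shows "partial 1 u = D"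
  using assms unfolding partial_def slice_has_partial_iff(1)[symmetric]
  by (auto simp: fun_eq_iff vector_derivative_at)

lemma partial_2_eqI:
  assumes "\<And>x q. ((\<lambda>q. u (x, q)) has_vector_derivative D (x, q)) (at q)"
  shows "partial 2 u = D"
  using assms unfolding partial_def slice_has_partial_iff(2)[symmetric]
  by (auto simp: fun_eq_iff vector_derivative_at)

text \<open>Removing the innermost derivative instead of the outermost one makes induction on the index list
  possible without any symmetry of mixed derivatives: the shorter list acts on \<open>partial i u\<close>.\<close>

lemma partials_snoc: "partials (is @ [i]) u = partials is (partial i u)"
  by (simp add: partials_def)

lemma smooth_partial:
  assumes "smooth u" "i \<in> {1, 2}"
  shows "smooth (partial i u)"
  unfolding smooth_def partials_snoc[symmetric]
  using assms by (auto simp: smooth_def simp del: One_nat_def)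

lemma smooth_continuous: "smooth u \<Longrightarrow> continuous_on UNIV u"
  unfolding smooth_def by (drule spec[of _ "[]"]) (simp add: partials_def)

lemma smooth_has_partial:
  assumes "smooth u"
  shows "((\<lambda>x. u (x, q)) has_vector_derivative partial 1 u (x, q)) (at x)"
    and "((\<lambda>q. u (x, q)) has_vector_derivative partial 2 u (x, q)) (at q)"
proof -
  have "\<forall>i\<in>{1, 2}. \<forall>z. (\<lambda>t. u (z + t *\<^sub>R axis_dir i)) differentiable (at 0)"
    using assms unfolding smooth_def by (auto dest!: spec[of _ "[]"] simp: partials_def)
  then show "((\<lambda>x. u (x, q)) has_vector_derivative partial 1 u (x, q)) (at x)"
    and "((\<lambda>q. u (x, q)) has_vector_derivative partial 2 u (x, q)) (at q)"
    unfolding slice_has_partial_iff[symmetric] partial_def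
    by (auto simp: vector_derivative_works)
qed

text \<open>Smoothness is the largest property that implies continuity and partial differentiability and is
  inherited by both partial derivatives, so it suffices to exhibit one family of such functions that
  is closed under differentiation.\<close>

lemma smooth_coinduct:
  assumes "u \<in> S"
    and cont: "\<And>v. v \<in> S \<Longrightarrow> continuous_on UNIV v"
    and d1: "\<And>v. v \<in> S \<Longrightarrow> \<exists>w\<in>S. \<forall>x q. ((\<lambda>x. v (x, q)) has_vector_derivative w (x, q)) (at x)"
    and d2: "\<And>v. v \<in> S \<Longrightarrow> \<exists>w\<in>S. \<forall>x q. ((\<lambda>q. v (x, q)) has_vector_derivative w (x, q)) (at q)"
  shows "smooth u"
proof -
  have 1: "partial 1 v \<in> S \<and> (\<forall>z. (\<lambda>t. v (z + t *\<^sub>R axis_dir 1)) differentiable (at 0))" if v: "v \<in> S" for v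
  proof -
    obtain w where w: "w \<in> S" "\<And>x q. ((\<lambda>x. v (x, q)) has_vector_derivative w (x, q)) (at x)"
      using d1[OF v] by blast
    then show ?thesis
      using w(2)[unfolded slice_has_partial_iff(1)[symmetric]]
      by (force simp: partial_1_eqI[OF w(2)] intro: differentiableI_vector simp del: One_nat_def)
  qed
  have 2: "partial 2 v \<in> S \<and> (\<forall>z. (\<lambda>t. v (z + t *\<^sub>R axis_dir 2)) differentiable (at 0))" if v: "v \<in> S" for v
  proof -
    obtain w where w: "w \<in> S" "\<And>x q. ((\<lambda>q. v (x, q)) has_vector_derivative w (x, q)) (at q)"
      using d2[OF v] by blast
    then show ?thesis
      using w(2)[unfolded slice_has_partial_iff(2)[symmetric]]
      by (force simp: partial_2_eqI[OF w(2)] intro: differentiableI_vector simp del: One_nat_def)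
  qed
  have "partials is u \<in> S" if "set is \<subseteq> {1, 2}" for "is"
    using that
  proof (induction "is")
    case Nil
    then show ?case using assms(1) by (simp add: partials_def)
  next
    case (Cons i "is")
    then have "partials is u \<in> S" by simp
    then have "partial i (partials is u) \<in> S" using Cons.prems 1 2 by auto
    then show ?case by (simp add: partials_def)
  qed
  then show ?thesis
    unfolding smooth_def using cont 1 2 by blast
qed

text \<open>The product rule leaves the set of products of smooth functions, but not the algebra generated by
  the smooth functions, which therefore is a family to which coinduction applies.\<close>

inductive_set smooth_algebra :: "(real \<times> real \<Rightarrow> complex) set" where
  base: "smooth u \<Longrightarrow> u \<in> smooth_algebra"
| add: "u \<in> smooth_algebra \<Longrightarrow> v \<in> smooth_algebra \<Longrightarrow> (\<lambda>z. u z + v z) \<in> smooth_algebra"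
| mult: "u \<in> smooth_algebra \<Longrightarrow> v \<in> smooth_algebra \<Longrightarrow> (\<lambda>z. u z * v z) \<in> smooth_algebra"

lemma smooth_algebra_smooth:
  assumes "u \<in> smooth_algebra"
  shows "smooth u"
proof (rule smooth_coinduct[OF assms])
  fix v assume "v \<in> smooth_algebra"
  then show "continuous_on UNIV v"
    by induction (auto intro: smooth_continuous continuous_intros)
next
  fix v assume "v \<in> smooth_algebra"
  then show "\<exists>w\<in>smooth_algebra. \<forall>x q. ((\<lambda>x. v (x, q)) has_vector_derivative w (x, q)) (at x)"
  proof induction
    case (base u)
    then show ?case
      using smooth_has_partial(1)[OF base] smooth_partial[OF base, of 1] smooth_algebra.base by blast
  next
    case (add u v)
    then obtain u' v' where "u' \<in> smooth_algebra" "v' \<in> smooth_algebra"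
      "\<And>x q. ((\<lambda>x. u (x, q)) has_vector_derivative u' (x, q)) (at x)"
      "\<And>x q. ((\<lambda>x. v (x, q)) has_vector_derivative v' (x, q)) (at x)" by blast
    then show ?case
      by (intro bexI[of _ "\<lambda>z. u' z + v' z"]) (auto intro: has_vector_derivative_add smooth_algebra.add)
  next
    case (mult u v)
    then obtain u' v' where "u' \<in> smooth_algebra" "v' \<in> smooth_algebra"
      "\<And>x q. ((\<lambda>x. u (x, q)) has_vector_derivative u' (x, q)) (at x)"
      "\<And>x q. ((\<lambda>x. v (x, q)) has_vector_derivative v' (x, q)) (at x)" by blast
    with mult show ?case
      by (intro bexI[of _ "\<lambda>z. u z * v' z + u' z * v z"])
        (auto intro: has_vector_derivative_mult smooth_algebra.add smooth_algebra.mult)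
  qed
next
  fix v assume "v \<in> smooth_algebra"
  then show "\<exists>w\<in>smooth_algebra. \<forall>x q. ((\<lambda>q. v (x, q)) has_vector_derivative w (x, q)) (at q)"
  proof induction
    case (base u)
    then show ?case
      using smooth_has_partial(2)[OF base] smooth_partial[OF base, of 2] smooth_algebra.base by blast
  next
    case (add u v)
    then obtain u' v' where "u' \<in> smooth_algebra" "v' \<in> smooth_algebra"
      "\<And>x q. ((\<lambda>q. u (x, q)) has_vector_derivative u' (x, q)) (at q)"
      "\<And>x q. ((\<lambda>q. v (x, q)) has_vector_derivative v' (x, q)) (at q)" by blast
    then show ?case
      by (intro bexI[of _ "\<lambda>z. u' z + v' z"]) (auto intro: has_vector_derivative_add smooth_algebra.add)
  next
    case (mult u v)
    then obtain u' v' where "u' \<in> smooth_algebra" "v' \<in> smooth_algebra"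
      "\<And>x q. ((\<lambda>q. u (x, q)) has_vector_derivative u' (x, q)) (at q)"
      "\<And>x q. ((\<lambda>q. v (x, q)) has_vector_derivative v' (x, q)) (at q)" by blast
    with mult show ?case
      by (intro bexI[of _ "\<lambda>z. u z * v' z + u' z * v z"])
        (auto intro: has_vector_derivative_mult smooth_algebra.add smooth_algebra.mult)
  qed
qed

lemma smooth_add: "smooth u \<Longrightarrow> smooth v \<Longrightarrow> smooth (\<lambda>z. u z + v z)"
  and smooth_mult: "smooth u \<Longrightarrow> smooth v \<Longrightarrow> smooth (\<lambda>z. u z * v z)"
  by (simp_all add: smooth_algebra_smooth smooth_algebra.intros)

lemma smooth_affine_fst: "smooth (\<lambda>(x, q). b * of_real x + c)"
proof (rule smooth_coinduct[where S = "range (\<lambda>(b, c) (x, q). b * of_real x + c)"])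
  show "(\<lambda>(x, q). b * complex_of_real x + c) \<in> range (\<lambda>(b, c) (x, q). b * of_real x + c)"
    by (intro image_eqI[of _ _ "(b, c)"]) auto
next
  fix v :: "real \<times> real \<Rightarrow> complex" assume "v \<in> range (\<lambda>(b, c) (x, q). b * of_real x + c)"
  then obtain b c where v: "v = (\<lambda>(x, q). b * of_real x + c)" by auto
  show "continuous_on UNIV v"
    unfolding v case_prod_beta by (intro continuous_intros)
  show "\<exists>w\<in>range (\<lambda>(b, c) (x, q). b * of_real x + c).
      \<forall>x q. ((\<lambda>x. v (x, q)) has_vector_derivative w (x, q)) (at x)"
    unfolding v
    by (intro bexI[of _ "\<lambda>(x, q). 0 * of_real x + b"] image_eqI[of _ _ "(0, b)"])
      (auto intro!: derivative_eq_intros)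
  show "\<exists>w\<in>range (\<lambda>(b, c) (x, q). b * of_real x + c).
      \<forall>x q. ((\<lambda>q. v (x, q)) has_vector_derivative w (x, q)) (at q)"
    unfolding v
    by (intro bexI[of _ "\<lambda>(x, q). 0 * of_real x + 0"] image_eqI[of _ _ "(0, 0)"])
      (auto intro!: derivative_eq_intros)
qed

lemma exp_affine_has_vector_derivative:
  fixes u v :: complex
  shows "((\<lambda>t. exp (u + v * of_real t)) has_vector_derivative v * exp (u + v * of_real t)) (at t within S)"
  by (rule has_vector_derivative_real_field) (auto intro!: derivative_eq_intros)

lemma smooth_exp_skew: "smooth (\<lambda>(x, q). c * exp (w * of_real (q - x / 2)))"
proof (rule smooth_coinduct[where S = "range (\<lambda>c (x, q). c * exp (w * of_real (q - x / 2)))"])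
  show "(\<lambda>(x, q). c * exp (w * of_real (q - x / 2))) \<in> range (\<lambda>c (x, q). c * exp (w * of_real (q - x / 2)))"
    by auto
next
  fix v :: "real \<times> real \<Rightarrow> complex"
  assume "v \<in> range (\<lambda>c (x, q). c * exp (w * of_real (q - x / 2)))"
  then obtain c where v: "v = (\<lambda>(x, q). c * exp (w * of_real (q - x / 2)))" by auto
  show "continuous_on UNIV v"
    unfolding v case_prod_beta by (intro continuous_intros) auto
  have "((\<lambda>x. v (x, q)) has_vector_derivative (- c * w / 2) * exp (w * of_real (q - x / 2))) (at x)" for x q
    using has_vector_derivative_mult_right[OF exp_affine_has_vector_derivative[of "w * of_real q" "- w / 2" x UNIV], of c]
    by (simp add: v algebra_simps)
  then show "\<exists>w'\<in>range (\<lambda>c (x, q). c * exp (w * of_real (q - x / 2))).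
      \<forall>x q. ((\<lambda>x. v (x, q)) has_vector_derivative w' (x, q)) (at x)"
    by (intro bexI[of _ "\<lambda>(x, q). (- c * w / 2) * exp (w * of_real (q - x / 2))"] image_eqI[of _ _ "- c * w / 2"]) auto
  have "((\<lambda>q. v (x, q)) has_vector_derivative (c * w) * exp (w * of_real (q - x / 2))) (at q)" for x q
    using has_vector_derivative_mult_right[OF exp_affine_has_vector_derivative[of "- w * of_real x / 2" w q UNIV], of c]
    by (simp add: v algebra_simps)
  then show "\<exists>w'\<in>range (\<lambda>c (x, q). c * exp (w * of_real (q - x / 2))).
      \<forall>x q. ((\<lambda>q. v (x, q)) has_vector_derivative w' (x, q)) (at q)"
    by (intro bexI[of _ "\<lambda>(x, q). (c * w) * exp (w * of_real (q - x / 2))"] image_eqI[of _ _ "c * w"]) auto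
qed

section \<open>Fourier inversion on the line\<close>

text \<open>The Gaussian is its own Fourier transform; this is the characteristic function of the standard
  normal distribution, written as an integral with respect to Lebesgue measure.\<close>

lemma std_gaussian_fourier:
  shows "integrable lborel (\<lambda>r. exp (\<i> * of_real (r * y)) * complex_of_real (exp (- r\<^sup>2 / 2)))" (is ?int)
    and "(LINT r|lborel. exp (\<i> * of_real (r * y)) * complex_of_real (exp (- r\<^sup>2 / 2)))
      = of_real (sqrt (2 * pi) * exp (- y\<^sup>2 / 2))" (is ?val)
proof -
  interpret real_distribution std_normal_distribution by (rule real_dist_normal_dist)
  have eq: "std_normal_density r *\<^sub>R iexp (y * r) =
      of_real (1 / sqrt (2 * pi)) * (exp (\<i> * of_real (r * y)) * of_real (exp (- r\<^sup>2 / 2)))" for r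
    by (simp add: std_normal_density_def scaleR_conv_of_real mult_ac)
  have "integrable std_normal_distribution (\<lambda>r. iexp (y * r))"
    by (rule integrable_const_bound[where B = 1]) auto
  then have i: "integrable lborel (\<lambda>r. std_normal_density r *\<^sub>R iexp (y * r))"
    by (subst (asm) integrable_density) (auto simp: normal_density_nonneg)
  from integrable_mult_right[OF i, of "of_real (sqrt (2 * pi))"] show ?int
    unfolding eq by (simp add: mult.assoc[symmetric] of_real_mult[symmetric] del: of_real_mult)
  have "of_real (exp (- y\<^sup>2 / 2)) = char std_normal_distribution y"
    by (simp add: char_std_normal_distribution)
  also have "\<dots> = (LINT r|lborel. std_normal_density r *\<^sub>R iexp (y * r))"
    unfolding char_def by (rule integral_density) (auto simp: normal_density_nonneg)
  also have "\<dots> = of_real (1 / sqrt (2 * pi)) *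
      (LINT r|lborel. exp (\<i> * of_real (r * y)) * complex_of_real (exp (- r\<^sup>2 / 2)))"
    unfolding eq by (rule integral_mult_right_zero)
  finally show ?val by (simp add: field_simps)
qed

lemma gaussian_fourier:
  assumes "e > 0"
  shows "integrable lborel (\<lambda>p. exp (\<i> * of_real (p * y)) * complex_of_real (exp (- (e * p)\<^sup>2 / 2)))" (is ?int)
    and "(LINT p|lborel. exp (\<i> * of_real (p * y)) * complex_of_real (exp (- (e * p)\<^sup>2 / 2)))
      = of_real (sqrt (2 * pi) / e * exp (- (y / e)\<^sup>2 / 2))" (is ?val)
proof -
  let ?g = "\<lambda>r. exp (\<i> * of_real (r * (y / e))) * complex_of_real (exp (- r\<^sup>2 / 2))"
  have eq: "?g (0 + e * p) = exp (\<i> * of_real (p * y)) * complex_of_real (exp (- (e * p)\<^sup>2 / 2))" for p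
    using assms by simp
  show ?int
    using lborel_integrable_real_affine[OF std_gaussian_fourier(1)[of "y / e"], of e 0] assms
    unfolding eq by simp
  show ?val
    using lborel_integral_real_affine[of e ?g 0] assms
    unfolding std_gaussian_fourier(2) eq by (simp add: scaleR_conv_of_real field_simps)
qed

text \<open>With the convergence factor \<open>exp (- (e p)\<^sup>2 / 2)\<close> the double integral is absolutely convergent.
  By Fubini the \<open>p\<close>-integral can be carried out first; it gives a Gaussian of width \<open>e\<close> centred at
  \<open>y\<close>, and the substitution \<open>x = y + e r\<close> moves the dependence on \<open>e\<close> into \<open>\<phi>\<close>.\<close>

lemma gaussian_regularized_inversion:
  fixes \<phi> :: "real \<Rightarrow> complex"
  assumes int: "integrable lborel \<phi>" and "e > 0"
  shows "(LINT p|lborel. (exp (- \<i> * of_real (p * y)) * (LINT x|lborel. exp (\<i> * of_real (p * x)) * \<phi> x))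
        * of_real (exp (- (e * p)\<^sup>2 / 2)))
    = of_real (sqrt (2 * pi)) * (LINT r|lborel. \<phi> (y + e * r) * of_real (exp (- r\<^sup>2 / 2)))"
proof -
  have [measurable]: "\<phi> \<in> borel_measurable borel" using int by auto
  let ?w = "\<lambda>p. complex_of_real (exp (- (e * p)\<^sup>2 / 2))"
  let ?K = "\<lambda>x p. exp (\<i> * of_real (p * (x - y))) * \<phi> x * ?w p"
  have w: "integrable lborel ?w"
    using gaussian_fourier(1)[OF \<open>e > 0\<close>, of 0] by simp
  have K: "integrable (lborel \<Otimes>\<^sub>M lborel) (case_prod ?K)"
  proof (rule lborel_pair.Fubini_integrable)
    have "norm (case_prod ?K (x, p)) = norm (\<phi> x) * norm (?w p)" for x p
      by (simp add: norm_mult)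
    then have "(LINT p|lborel. norm (case_prod ?K (x, p))) = norm (\<phi> x) * (LINT p|lborel. norm (?w p))" for x
      by simp
    then show "integrable lborel (\<lambda>x. LINT p|lborel. norm (case_prod ?K (x, p)))"
      using int by simp
    have "integrable lborel (\<lambda>p. \<phi> x * (exp (\<i> * of_real (p * (x - y))) * ?w p))" for x
      by (intro integrable_mult_right gaussian_fourier(1) \<open>e > 0\<close>)
    then show "AE x in lborel. integrable lborel (\<lambda>p. case_prod ?K (x, p))"
      by (simp add: mult_ac)
  qed measurable
  have "(exp (- \<i> * of_real (p * y)) * (LINT x|lborel. exp (\<i> * of_real (p * x)) * \<phi> x)) * ?w p
      = (LINT x|lborel. ?K x p)" for p
  proof -
    have "exp (- \<i> * of_real (p * y)) * (exp (\<i> * of_real (p * x)) * \<phi> x) * ?w p = ?K x p" for x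
    proof -
      have "exp (- \<i> * of_real (p * y)) * exp (\<i> * of_real (p * x)) = exp (\<i> * of_real (p * (x - y)))"
        by (simp add: exp_add[symmetric] algebra_simps)
      then show ?thesis by (simp only: mult.assoc[symmetric])
    qed
    then show ?thesis
      by (simp only: integral_mult_right_zero[symmetric] integral_mult_left_zero[symmetric])
  qed
  then have "(LINT p|lborel. (exp (- \<i> * of_real (p * y)) * (LINT x|lborel. exp (\<i> * of_real (p * x)) * \<phi> x)) * ?w p)
    = (LINT p|lborel. LINT x|lborel. ?K x p)" by simp
  also have "\<dots> = (LINT x|lborel. LINT p|lborel. ?K x p)"
    by (rule lborel_pair.Fubini_integral[OF K])
  also have "\<dots> = (LINT x|lborel. \<phi> x * of_real (sqrt (2 * pi) / e * exp (- ((x - y) / e)\<^sup>2 / 2)))" (is "_ = integral\<^sup>L _ ?h")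
  proof -
    have "(LINT p|lborel. ?K x p) = ?h x" for x
    proof -
      have "(LINT p|lborel. ?K x p) = (LINT p|lborel. \<phi> x * (exp (\<i> * of_real (p * (x - y))) * ?w p))"
        by (simp add: mult_ac)
      also have "\<dots> = \<phi> x * (LINT p|lborel. exp (\<i> * of_real (p * (x - y))) * ?w p)"
        by (rule integral_mult_right_zero)
      also have "\<dots> = ?h x"
        by (simp only: gaussian_fourier(2)[OF \<open>e > 0\<close>])
      finally show ?thesis .
    qed
    then show ?thesis by simp
  qed
  also have "\<dots> = e *\<^sub>R (LINT r|lborel. ?h (y + e * r))"
    using lborel_integral_real_affine[of e ?h y] \<open>e > 0\<close> by simp
  also have "\<dots> = (LINT r|lborel. of_real e * ?h (y + e * r))"
    by (simp only: scaleR_conv_of_real integral_mult_right_zero)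
  also have "\<dots> = (LINT r|lborel. of_real (sqrt (2 * pi)) * (\<phi> (y + e * r) * of_real (exp (- r\<^sup>2 / 2))))"
    using \<open>e > 0\<close> by (intro Bochner_Integration.integral_cong refl) simp
  also have "\<dots> = of_real (sqrt (2 * pi)) * (LINT r|lborel. \<phi> (y + e * r) * of_real (exp (- r\<^sup>2 / 2)))"
    by (rule integral_mult_right_zero)
  finally show ?thesis .
qed

text \<open>Let the width of the regularizing Gaussian tend to zero. Both sides of the regularized identity
  converge by dominated convergence: the left one is dominated by the integrable transform of \<open>\<phi>\<close>, the
  right one by a multiple of the Gaussian, and there \<open>\<phi> (y + e r)\<close> tends to \<open>\<phi> y\<close>.\<close>

theorem fourier_inversion:
  fixes \<phi> :: "real \<Rightarrow> complex"
  assumes int: "integrable lborel \<phi>"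
    and cont: "continuous_on UNIV \<phi>"
    and bound: "\<And>x. norm (\<phi> x) \<le> M"
    and hat: "integrable lborel (\<lambda>p. LINT x|lborel. exp (\<i> * of_real (p * x)) * \<phi> x)"
  shows "(LINT p|lborel. exp (- \<i> * of_real (p * y)) * (LINT x|lborel. exp (\<i> * of_real (p * x)) * \<phi> x))
    = 2 * of_real pi * \<phi> y"
proof -
  define hat where "hat p = (LINT x|lborel. exp (\<i> * of_real (p * x)) * \<phi> x)" for p
  define F where "F p = exp (- \<i> * of_real (p * y)) * hat p" for p
  define e where "e n = 1 / real (Suc n)" for n
  have e: "e n > 0" for n by (simp add: e_def)
  have e0: "e \<longlonglongrightarrow> 0" unfolding e_def by (rule LIMSEQ_Suc) (rule lim_1_over_n)
  have [measurable]: "hat \<in> borel_measurable borel"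
    using assms(4) by (auto simp: hat_def[abs_def])
  have [measurable]: "\<phi> \<in> borel_measurable borel" using int by auto
  have [measurable]: "F \<in> borel_measurable borel" unfolding F_def by measurable
  have "(\<lambda>n. LINT p|lborel. F p * of_real (exp (- (e n * p)\<^sup>2 / 2))) \<longlonglongrightarrow> integral\<^sup>L lborel F"
  proof (rule integral_dominated_convergence[where w = "\<lambda>p. norm (hat p)"])
    show "integrable lborel (\<lambda>p. norm (hat p))"
      using assms(4) by (simp add: hat_def[abs_def])
    have "(\<lambda>n. F p * of_real (exp (- (e n * p)\<^sup>2 / 2))) \<longlonglongrightarrow> F p * of_real (exp (- (0 * p)\<^sup>2 / 2))" for p
      by (intro tendsto_intros e0) auto
    then show "AE p in lborel. (\<lambda>n. F p * of_real (exp (- (e n * p)\<^sup>2 / 2))) \<longlonglongrightarrow> F p" by simp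
    show "AE p in lborel. norm (F p * of_real (exp (- (e n * p)\<^sup>2 / 2))) \<le> norm (hat p)" for n
    proof (rule AE_I2)
      fix p
      have "norm (F p) = norm (hat p)" by (simp add: F_def norm_mult)
      then show "norm (F p * of_real (exp (- (e n * p)\<^sup>2 / 2))) \<le> norm (hat p)"
        using mult_left_le[of "exp (- (e n * p)\<^sup>2 / 2)" "norm (hat p)"] by (simp add: norm_mult)
    qed
  qed measurable
  moreover have "(\<lambda>n. LINT r|lborel. \<phi> (y + e n * r) * of_real (exp (- r\<^sup>2 / 2)))
      \<longlonglongrightarrow> (LINT r|lborel. \<phi> y * of_real (exp (- r\<^sup>2 / 2)))"
  proof (rule integral_dominated_convergence[where w = "\<lambda>r. M * exp (- r\<^sup>2 / 2)"])
    have "integrable lborel (\<lambda>r. norm (complex_of_real (exp (- r\<^sup>2 / 2))))"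
      using std_gaussian_fourier(1)[of 0] by (intro integrable_norm) simp
    then show "integrable lborel (\<lambda>r. M * exp (- r\<^sup>2 / 2))" by simp
    have "(\<lambda>n. \<phi> (y + e n * r)) \<longlonglongrightarrow> \<phi> y" for r
    proof (rule continuous_on_tendsto_compose[OF cont])
      show "(\<lambda>n. y + e n * r) \<longlonglongrightarrow> y"
        using tendsto_add[OF tendsto_const tendsto_mult[OF e0 tendsto_const[of r]], of y] by simp
    qed auto
    then show "AE r in lborel. (\<lambda>n. \<phi> (y + e n * r) * of_real (exp (- r\<^sup>2 / 2)))
        \<longlonglongrightarrow> \<phi> y * of_real (exp (- r\<^sup>2 / 2))"
      by (intro AE_I2 tendsto_mult tendsto_const)
    show "AE r in lborel. norm (\<phi> (y + e n * r) * of_real (exp (- r\<^sup>2 / 2))) \<le> M * exp (- r\<^sup>2 / 2)" for n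
      using bound by (intro AE_I2) (simp add: norm_mult mult_right_mono)
  qed measurable
  then have "(\<lambda>n. of_real (sqrt (2 * pi)) * (LINT r|lborel. \<phi> (y + e n * r) * of_real (exp (- r\<^sup>2 / 2))))
      \<longlonglongrightarrow> of_real (sqrt (2 * pi)) * (LINT r|lborel. \<phi> y * of_real (exp (- r\<^sup>2 / 2)))"
    by (intro tendsto_mult tendsto_const)
  then have "(\<lambda>n. LINT p|lborel. F p * of_real (exp (- (e n * p)\<^sup>2 / 2)))
      \<longlonglongrightarrow> of_real (sqrt (2 * pi)) * (LINT r|lborel. \<phi> y * of_real (exp (- r\<^sup>2 / 2)))"
    unfolding F_def hat_def gaussian_regularized_inversion[OF int e] .
  ultimately have "integral\<^sup>L lborel F = of_real (sqrt (2 * pi)) * (LINT r|lborel. \<phi> y * of_real (exp (- r\<^sup>2 / 2)))"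
    by (rule LIMSEQ_unique)
  also have "(LINT r|lborel. \<phi> y * of_real (exp (- r\<^sup>2 / 2))) = \<phi> y * of_real (sqrt (2 * pi))"
    using std_gaussian_fourier(2)[of 0] by (simp del: of_real_exp)
  also have "of_real (sqrt (2 * pi)) * (\<phi> y * of_real (sqrt (2 * pi))) = of_real ((sqrt (2 * pi))\<^sup>2) * \<phi> y"
    by (simp only: power2_eq_square of_real_mult mult_ac)
  finally show ?thesis by (simp add: F_def[abs_def] hat_def)
qed

section \<open>Smooth functions supported in a strip\<close>

text \<open>Only the variable \<open>x\<close> is integrated, so a bound on the \<open>x\<close>-support, uniform in \<open>q\<close>, is what
  makes the Fourier integrals converge and admits differentiation under the integral sign. The class
  is stable under derivatives and under multiplication by smooth functions.\<close>

definition strip_smooth :: "(real \<times> real \<Rightarrow> complex) set" where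
  "strip_smooth = {F. smooth F \<and> (\<exists>R. \<forall>x q. R < \<bar>x\<bar> \<longrightarrow> F (x, q) = 0)}"

lemma strip_smooth_smooth: "F \<in> strip_smooth \<Longrightarrow> smooth F"
  by (simp add: strip_smooth_def)

lemma strip_smooth_bound:
  assumes "F \<in> strip_smooth"
  shows "\<exists>R>0. \<forall>x q. R < \<bar>x\<bar> \<longrightarrow> F (x, q) = 0"
proof -
  obtain R where "\<forall>x q. R < \<bar>x\<bar> \<longrightarrow> F (x, q) = 0"
    using assms by (auto simp: strip_smooth_def)
  then show ?thesis by (intro exI[of _ "max R 1"]) auto
qed

lemma Cc_infinity_subset_strip_smooth: "Cc_infinity \<subseteq> strip_smooth"
proof
  fix f assume f: "f \<in> Cc_infinity"
  then have "bounded {z. f z \<noteq> 0}"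
    using bounded_subset[OF compact_imp_bounded closure_subset] by (auto simp: Cc_infinity_def)
  then obtain R where R: "\<And>z. f z \<noteq> 0 \<Longrightarrow> norm z \<le> R"
    by (auto simp: bounded_iff)
  have "f (x, q) = 0" if "R < \<bar>x\<bar>" for x q
    using R[of "(x, q)"] norm_fst_le[of x q] that by force
  with f show "f \<in> strip_smooth" by (auto simp: strip_smooth_def Cc_infinity_def)
qed

lemma strip_smooth_mult:
  assumes "smooth u" "F \<in> strip_smooth"
  shows "(\<lambda>z. u z * F z) \<in> strip_smooth"
  using assms by (fastforce simp: strip_smooth_def intro: smooth_mult)

lemma strip_smooth_add:
  assumes "F \<in> strip_smooth" "G \<in> strip_smooth"
  shows "(\<lambda>z. F z + G z) \<in> strip_smooth"
proof -
  obtain R where "R > 0" and R: "\<forall>x q. R < \<bar>x\<bar> \<longrightarrow> F (x, q) = 0"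
    using strip_smooth_bound[OF assms(1)] by blast
  obtain S where "S > 0" and S: "\<forall>x q. S < \<bar>x\<bar> \<longrightarrow> G (x, q) = 0"
    using strip_smooth_bound[OF assms(2)] by blast
  have "\<forall>x q. max R S < \<bar>x\<bar> \<longrightarrow> F (x, q) + G (x, q) = 0" using R S by simp
  moreover have "smooth (\<lambda>z. F z + G z)"
    using assms by (intro smooth_add strip_smooth_smooth)
  ultimately show ?thesis unfolding strip_smooth_def by blast
qed

lemma partial_eq_0_outside_strip:
  assumes "smooth F" and R: "\<forall>x q. R < \<bar>x\<bar> \<longrightarrow> F (x, q) = 0" and x: "R < \<bar>x\<bar>"
  shows "partial 1 F (x, q) = 0" and "partial 2 F (x, q) = 0"
proof -
  have "open {x::real. R < \<bar>x\<bar>}" by (intro open_Collect_less continuous_intros)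
  then have "((\<lambda>x. F (x, q)) has_vector_derivative 0) (at x)"
    using x R by (intro has_vector_derivative_transform_within_open[OF has_vector_derivative_const[of 0]]) auto
  then show "partial 1 F (x, q) = 0"
    by (rule vector_derivative_unique_at[OF smooth_has_partial(1)[OF assms(1)]])
  have "((\<lambda>q. F (x, q)) has_vector_derivative 0) (at q)"
    using x R by simp
  then show "partial 2 F (x, q) = 0"
    by (rule vector_derivative_unique_at[OF smooth_has_partial(2)[OF assms(1)]])
qed

lemma strip_smooth_partial:
  assumes F: "F \<in> strip_smooth" and i: "i \<in> {1, 2}"
  shows "partial i F \<in> strip_smooth"
proof -
  obtain R where "R > 0" and R: "\<forall>x q. R < \<bar>x\<bar> \<longrightarrow> F (x, q) = 0"
    using strip_smooth_bound[OF F] by blast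
  from partial_eq_0_outside_strip[OF strip_smooth_smooth[OF F] R]
  have "\<forall>x q. R < \<bar>x\<bar> \<longrightarrow> partial i F (x, q) = 0" using i by auto
  then show ?thesis
    using smooth_partial[OF strip_smooth_smooth[OF F] i] by (auto simp: strip_smooth_def)
qed

lemma strip_smooth_continuous_slice:
  assumes "F \<in> strip_smooth"
  shows "continuous_on S (\<lambda>x. F (x, q))"
  by (intro continuous_on_compose2[OF smooth_continuous[OF strip_smooth_smooth[OF assms]]] continuous_intros) auto

section \<open>The partial Fourier transform on strip functions\<close>

lemma compactly_supported_integrable:
  fixes \<phi> :: "real \<Rightarrow> complex"
  assumes c: "continuous_on UNIV \<phi>" and z: "\<And>x. R < \<bar>x\<bar> \<Longrightarrow> \<phi> x = 0"
  shows "integrable lborel \<phi>" and "(LINT x|lborel. \<phi> x) = integral (cbox (- R) R) \<phi>"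
proof -
  have eq: "(\<lambda>x. if x \<in> cbox (- R) R then \<phi> x else 0) = \<phi>"
    using z by (auto simp: fun_eq_iff abs_le_iff not_le)
  have "integrable lborel (\<lambda>x. indicator (cbox (- R) R) x *\<^sub>R \<phi> x)"
    by (intro borel_integrable_compact compact_cbox continuous_on_subset[OF c] subset_UNIV)
  also have "(\<lambda>x. indicator (cbox (- R) R) x *\<^sub>R \<phi> x) = (\<lambda>x. if x \<in> cbox (- R) R then \<phi> x else 0)"
    by (auto simp: indicator_def)
  finally show i: "integrable lborel \<phi>" by (simp only: eq)
  have "(LINT x|lborel. \<phi> x) = integral UNIV \<phi>" by (rule integral_lborel[OF i, symmetric])
  also have "\<dots> = integral (cbox (- R) R) \<phi>"
    using integral_restrict_UNIV[of "cbox (- R) R" \<phi>] by (simp only: eq)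
  finally show "(LINT x|lborel. \<phi> x) = integral (cbox (- R) R) \<phi>" .
qed

lemma fourier_slice:
  assumes F: "F \<in> strip_smooth"
  shows fourier_slice_integrable: "integrable lborel (\<lambda>x. exp (\<i> * of_real (p * x)) * F (x, q))"
    and fourier_slice_integral: "\<forall>x q. R < \<bar>x\<bar> \<longrightarrow> F (x, q) = 0 \<Longrightarrow>
      (LINT x|lborel. exp (\<i> * of_real (p * x)) * F (x, q)) =
      integral (cbox (- R) R) (\<lambda>x. exp (\<i> * of_real (p * x)) * F (x, q))"
proof -
  have c: "continuous_on UNIV (\<lambda>x. exp (\<i> * of_real (p * x)) * F (x, q))"
    by (intro continuous_intros strip_smooth_continuous_slice[OF F])
  obtain S where "S > 0" and S: "\<forall>x q. S < \<bar>x\<bar> \<longrightarrow> F (x, q) = 0"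
    using strip_smooth_bound[OF F] by blast
  show "integrable lborel (\<lambda>x. exp (\<i> * of_real (p * x)) * F (x, q))"
    by (rule compactly_supported_integrable(1)[OF c, of S]) (simp add: S)
  show "(LINT x|lborel. exp (\<i> * of_real (p * x)) * F (x, q)) =
      integral (cbox (- R) R) (\<lambda>x. exp (\<i> * of_real (p * x)) * F (x, q))"
    if "\<forall>x q. R < \<bar>x\<bar> \<longrightarrow> F (x, q) = 0"
    using that by (intro compactly_supported_integrable(2)[OF c]) auto
qed

lemma fourier_p_inv_add:
  assumes "F \<in> strip_smooth" "G \<in> strip_smooth"
  shows "fourier_p_inv (\<lambda>z. F z + G z) z = fourier_p_inv F z + fourier_p_inv G z"
  using assms
  by (simp add: fourier_p_inv_def case_prod_beta distrib_left fourier_slice_integrable del: of_real_mult)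

lemma strip_smooth_cmult: "F \<in> strip_smooth \<Longrightarrow> (\<lambda>z. c * F z) \<in> strip_smooth"
  using strip_smooth_mult[OF smooth_affine_fst[of 0 c], of F] by (simp add: case_prod_beta)

lemma fourier_p_inv_cmult: "fourier_p_inv (\<lambda>z. c * F z) z = c * fourier_p_inv F z"
  by (simp add: fourier_p_inv_def case_prod_beta mult.left_commute[of _ c] del: of_real_mult)

text \<open>The counterpart of \<open>\<partial>\<^sub>p\<close> under \<open>fourier_p_inv\<close>.\<close>

definition times_ix :: "(real \<times> real \<Rightarrow> complex) \<Rightarrow> real \<times> real \<Rightarrow> complex" where
  "times_ix F = (\<lambda>z. \<i> * of_real (fst z) * F z)"

lemma strip_smooth_times_ix:
  assumes "F \<in> strip_smooth"
  shows "times_ix F \<in> strip_smooth"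
  using strip_smooth_mult[OF smooth_affine_fst[of "\<i>" 0] assms]
  by (simp add: times_ix_def case_prod_beta)

lemma partial_2_times_ix:
  assumes "F \<in> strip_smooth"
  shows "partial 2 (times_ix F) = times_ix (partial 2 F)"
proof (rule partial_2_eqI)
  fix x q
  show "((\<lambda>q. times_ix F (x, q)) has_vector_derivative times_ix (partial 2 F) (x, q)) (at q)"
    unfolding times_ix_def fst_conv
    by (intro has_vector_derivative_mult_right smooth_has_partial(2) strip_smooth_smooth assms)
qed

lemma continuous_on_fourier_p_inv:
  assumes F: "F \<in> strip_smooth"
  shows "continuous_on UNIV (fourier_p_inv F)"
proof -
  obtain R where "R > 0" and R: "\<forall>x q. R < \<bar>x\<bar> \<longrightarrow> F (x, q) = 0"
    using strip_smooth_bound[OF F] by blast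
  have "continuous_on UNIV (\<lambda>z. integral (cbox (- R) R) (\<lambda>x. exp (\<i> * of_real (fst z * x)) * F (x, snd z)))"
    unfolding case_prod_beta
    by (intro integral_continuous_on_param) (auto simp: case_prod_beta intro!: continuous_intros
        continuous_on_compose2[OF smooth_continuous[OF strip_smooth_smooth[OF F]]])
  then have "continuous_on UNIV (\<lambda>z. complex_of_real (1 / sqrt (2 * pi)) *
      integral (cbox (- R) R) (\<lambda>x. exp (\<i> * of_real (fst z * x)) * F (x, snd z)))"
    by (intro continuous_on_mult continuous_on_const)
  then show ?thesis
    unfolding fourier_p_inv_def case_prod_beta fourier_slice_integral[OF F R] .
qed

text \<open>Differentiation under the integral sign, legitimate because all slices are supported in one compact
  interval, over which the integrand has a jointly continuous derivative.\<close>

lemma fourier_p_inv_has_derivative: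
  assumes F: "F \<in> strip_smooth"
  shows "((\<lambda>p. fourier_p_inv F (p, q)) has_vector_derivative fourier_p_inv (times_ix F) (p, q)) (at p)"
    and "((\<lambda>q. fourier_p_inv F (p, q)) has_vector_derivative fourier_p_inv (partial 2 F) (p, q)) (at q)"
proof -
  obtain R where "R > 0" and R: "\<forall>x q. R < \<bar>x\<bar> \<longrightarrow> F (x, q) = 0"
    using strip_smooth_bound[OF F] by blast
  then have R1: "\<forall>x q. R < \<bar>x\<bar> \<longrightarrow> times_ix F (x, q) = 0" by (simp add: times_ix_def)
  have R2: "\<forall>x q. R < \<bar>x\<bar> \<longrightarrow> partial 2 F (x, q) = 0"
    using partial_eq_0_outside_strip(2)[OF strip_smooth_smooth[OF F] R] by blast
  note F1 = strip_smooth_times_ix[OF F]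
  note F2 = strip_smooth_partial[OF F, of 2, simplified]
  note cont = continuous_on_compose2[OF smooth_continuous[OF strip_smooth_smooth]]
  have "((\<lambda>p. integral (cbox (- R) R) (\<lambda>x. exp (\<i> * of_real (p * x)) * F (x, q))) has_vector_derivative
      integral (cbox (- R) R) (\<lambda>x. exp (\<i> * of_real (p * x)) * times_ix F (x, q))) (at p within UNIV)"
  proof (rule leibniz_rule_vector_derivative)
    fix p x
    show "((\<lambda>p. exp (\<i> * of_real (p * x)) * F (x, q)) has_vector_derivative
        exp (\<i> * of_real (p * x)) * times_ix F (x, q)) (at p within UNIV)"
      using has_vector_derivative_mult_left[OF exp_affine_has_vector_derivative[of 0 "\<i> * of_real x" p UNIV], of "F (x, q)"]
      by (simp add: times_ix_def mult_ac)
  next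
    show "(\<lambda>x. exp (\<i> * of_real (p * x)) * F (x, q)) integrable_on cbox (- R) R" for p
      by (intro integrable_continuous continuous_intros cont[OF F]) auto
    show "continuous_on (UNIV \<times> cbox (- R) R) (\<lambda>(p, x). exp (\<i> * of_real (p * x)) * times_ix F (x, q))"
      unfolding case_prod_beta by (intro continuous_intros cont[OF F1]) auto
  qed auto
  from has_vector_derivative_mult_right[OF this]
  show "((\<lambda>p. fourier_p_inv F (p, q)) has_vector_derivative fourier_p_inv (times_ix F) (p, q)) (at p)"
    unfolding fourier_p_inv_def prod.case fourier_slice_integral[OF F R] fourier_slice_integral[OF F1 R1] .
  have "((\<lambda>q. integral (cbox (- R) R) (\<lambda>x. exp (\<i> * of_real (p * x)) * F (x, q))) has_vector_derivative
      integral (cbox (- R) R) (\<lambda>x. exp (\<i> * of_real (p * x)) * partial 2 F (x, q))) (at q within UNIV)"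
  proof (rule leibniz_rule_vector_derivative)
    show "((\<lambda>q. exp (\<i> * of_real (p * x)) * F (x, q)) has_vector_derivative
        exp (\<i> * of_real (p * x)) * partial 2 F (x, q)) (at q within UNIV)" for q x
      by (intro has_vector_derivative_mult_right smooth_has_partial(2) strip_smooth_smooth F)
    show "(\<lambda>x. exp (\<i> * of_real (p * x)) * F (x, q)) integrable_on cbox (- R) R" for q
      by (intro integrable_continuous continuous_intros cont[OF F]) auto
    show "continuous_on (UNIV \<times> cbox (- R) R) (\<lambda>(q, x). exp (\<i> * of_real (p * x)) * partial 2 F (x, q))"
      unfolding case_prod_beta by (intro continuous_intros cont[OF F2]) auto
  qed auto
  from has_vector_derivative_mult_right[OF this]
  show "((\<lambda>q. fourier_p_inv F (p, q)) has_vector_derivative fourier_p_inv (partial 2 F) (p, q)) (at q)"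
    unfolding fourier_p_inv_def prod.case fourier_slice_integral[OF F R] fourier_slice_integral[OF F2 R2] .
qed

lemma partial_1_fourier_p_inv:
  "F \<in> strip_smooth \<Longrightarrow> partial 1 (fourier_p_inv F) = fourier_p_inv (times_ix F)"
  by (rule partial_1_eqI) (rule fourier_p_inv_has_derivative)

lemma partial_2_fourier_p_inv:
  "F \<in> strip_smooth \<Longrightarrow> partial 2 (fourier_p_inv F) = fourier_p_inv (partial 2 F)"
  by (rule partial_2_eqI) (rule fourier_p_inv_has_derivative)

text \<open>The image of \<open>strip_smooth\<close> is closed under both derivatives, because they correspond to
  \<open>times_ix\<close> and \<open>partial 2\<close>.\<close>

lemma smooth_fourier_p_inv:
  assumes "F \<in> strip_smooth"
  shows "smooth (fourier_p_inv F)"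
proof (rule smooth_coinduct[where S = "fourier_p_inv ` strip_smooth"])
  show "fourier_p_inv F \<in> fourier_p_inv ` strip_smooth" using assms by simp
next
  fix v assume "v \<in> fourier_p_inv ` strip_smooth"
  then obtain G where G: "v = fourier_p_inv G" "G \<in> strip_smooth" by auto
  show "continuous_on UNIV v" using G continuous_on_fourier_p_inv by simp
  show "\<exists>w\<in>fourier_p_inv ` strip_smooth. \<forall>x q. ((\<lambda>x. v (x, q)) has_vector_derivative w (x, q)) (at x)"
    using fourier_p_inv_has_derivative(1)[OF G(2)] strip_smooth_times_ix[OF G(2)] unfolding G(1) by blast
  show "\<exists>w\<in>fourier_p_inv ` strip_smooth. \<forall>x q. ((\<lambda>q. v (x, q)) has_vector_derivative w (x, q)) (at q)"
    using fourier_p_inv_has_derivative(2)[OF G(2)] strip_smooth_partial[OF G(2), of 2] unfolding G(1) by blast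
qed

text \<open>Integration by parts: \<open>exp (i p x) (i p F + \<partial>\<^sub>x F)\<close> is the \<open>x\<close>-derivative of
  \<open>exp (i p x) F\<close>, which vanishes at both ends of an interval containing the support.\<close>

lemma fourier_p_inv_partial_1:
  assumes F: "F \<in> strip_smooth"
  shows "fourier_p_inv (partial 1 F) (p, q) = - \<i> * of_real p * fourier_p_inv F (p, q)"
proof -
  obtain R where R: "R > 0" "\<forall>x q. R < \<bar>x\<bar> \<longrightarrow> F (x, q) = 0" using strip_smooth_bound[OF F] by blast
  \<comment> \<open>\<open>F\<close> is known to vanish strictly beyond \<open>R\<close>, hence at both ends of the larger interval.\<close>
  define S where "S = R + 1"
  have F1: "partial 1 F \<in> strip_smooth" by (rule strip_smooth_partial[OF F]) simp
  define D where "D = (\<lambda>z. \<i> * of_real p * F z + partial 1 F z)"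
  have D: "D \<in> strip_smooth"
    unfolding D_def by (intro strip_smooth_add strip_smooth_cmult F F1)
  have S: "\<forall>x q. S < \<bar>x\<bar> \<longrightarrow> D (x, q) = 0"
    using partial_eq_0_outside_strip(1)[OF strip_smooth_smooth[OF F] R(2)] R(2)
    by (simp add: D_def S_def)
  have "((\<lambda>x. exp (\<i> * of_real (p * x)) * F (x, q)) has_vector_derivative
      exp (\<i> * of_real (p * x)) * D (x, q)) (at x within T)" for x T
    using has_vector_derivative_mult[OF exp_affine_has_vector_derivative[of 0 "\<i> * of_real p" x T]
        has_vector_derivative_at_within[OF smooth_has_partial(1)[OF strip_smooth_smooth[OF F], of q x]]]
    by (simp add: D_def algebra_simps)
  then have "((\<lambda>x. exp (\<i> * of_real (p * x)) * D (x, q)) has_integral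
      exp (\<i> * of_real (p * S)) * F (S, q) - exp (\<i> * of_real (p * - S)) * F (- S, q)) {- S..S}"
    using R(1) by (intro fundamental_theorem_of_calculus) (auto simp: S_def)
  then have "integral (cbox (- S) S) (\<lambda>x. exp (\<i> * of_real (p * x)) * D (x, q)) = 0"
    using R by (simp add: S_def integral_unique)
  then have "fourier_p_inv D (p, q) = 0"
    unfolding fourier_p_inv_def prod.case fourier_slice_integral[OF D S] by (simp only: mult_zero_right)
  moreover have "fourier_p_inv D (p, q) = \<i> * of_real p * fourier_p_inv F (p, q) + fourier_p_inv (partial 1 F) (p, q)"
    using fourier_p_inv_add[OF strip_smooth_cmult[OF F] F1] by (simp add: D_def fourier_p_inv_cmult)
  ultimately show ?thesis by (simp add: add_eq_0_iff)
qed

lemma norm_fourier_p_inv_le: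
  assumes "F \<in> strip_smooth"
  shows "norm (fourier_p_inv F (p, q)) \<le> LINT x|lborel. norm (F (x, q))"
proof -
  let ?I = "LINT x|lborel. exp (\<i> * of_real (p * x)) * F (x, q)"
  have "norm (fourier_p_inv F (p, q)) = (1 / sqrt (2 * pi)) * norm ?I"
    by (simp add: fourier_p_inv_def norm_mult norm_divide)
  also have "\<dots> \<le> 1 * norm ?I"
    using pi_gt3 by (intro mult_right_mono) auto
  also have "\<dots> \<le> (LINT x|lborel. norm (exp (\<i> * of_real (p * x)) * F (x, q)))"
    by (simp only: mult_1 integral_norm_bound)
  also have "\<dots> = (LINT x|lborel. norm (F (x, q)))" by (simp add: norm_mult)
  finally show ?thesis .
qed

text \<open>Integration by parts twice bounds \<open>(1 + p\<^sup>2) fourier_p_inv F\<close> by the \<open>L\<^sup>1\<close>-norms of \<open>F\<close> and of its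
  second \<open>x\<close>-derivative on the line.\<close>

lemma fourier_p_inv_fourier_dom:
  assumes F: "F \<in> strip_smooth"
  shows "fourier_p_inv F \<in> fourier_dom"
proof -
  have "integrable lborel (\<lambda>p. fourier_p_inv F (p, q))" for q
  proof -
    have F11: "partial 1 (partial 1 F) \<in> strip_smooth"
      using F strip_smooth_partial by blast
    define C where "C = (LINT x|lborel. norm (F (x, q))) + (LINT x|lborel. norm (partial 1 (partial 1 F) (x, q)))"
    have w: "integrable lborel (\<lambda>p::real. C * inverse (1 + p\<^sup>2))"
      using integrable_inverse_1_plus_square by (simp add: set_integrable_def)
    have le: "norm (fourier_p_inv F (p, q)) \<le> norm (C * inverse (1 + p\<^sup>2))" for p
    proof -
      have "fourier_p_inv (partial 1 (partial 1 F)) (p, q) = - (of_real (p\<^sup>2) * fourier_p_inv F (p, q))"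
        using F strip_smooth_partial[OF F, of 1]
        by (simp add: fourier_p_inv_partial_1 power2_eq_square mult_ac del: One_nat_def)
      then have "of_real (1 + p\<^sup>2) * fourier_p_inv F (p, q)
          = fourier_p_inv F (p, q) - fourier_p_inv (partial 1 (partial 1 F)) (p, q)"
        by (simp add: algebra_simps)
      then have "norm (of_real (1 + p\<^sup>2) * fourier_p_inv F (p, q)) \<le> C"
        unfolding C_def
        using norm_triangle_ineq4[of "fourier_p_inv F (p, q)" "fourier_p_inv (partial 1 (partial 1 F)) (p, q)"]
          norm_fourier_p_inv_le[OF F, of p q] norm_fourier_p_inv_le[OF F11, of p q] by simp
      then have le: "(1 + p\<^sup>2) * norm (fourier_p_inv F (p, q)) \<le> C"
        by (simp only: norm_mult norm_of_real) simp
      have "1 + p\<^sup>2 > 0" by (simp add: add_pos_nonneg)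
      then have "norm (fourier_p_inv F (p, q)) \<le> C * inverse (1 + p\<^sup>2)"
        using le by (simp add: field_simps)
      then show ?thesis by (simp add: order_trans[OF _ abs_ge_self])
    qed
    have "continuous_on UNIV (\<lambda>p. fourier_p_inv F (p, q))"
      by (intro continuous_on_compose2[OF continuous_on_fourier_p_inv[OF F]] continuous_intros) auto
    then have "(\<lambda>p. fourier_p_inv F (p, q)) \<in> borel_measurable lborel"
      by (simp add: borel_measurable_continuous_onI)
    then show ?thesis
      using le by (intro Bochner_Integration.integrable_bound[OF w]) auto
  qed
  then show ?thesis by (simp add: fourier_dom_def)
qed

lemma fourier_p_fourier_p_inv:
  assumes F: "F \<in> strip_smooth"
  shows "fourier_p (fourier_p_inv F) = F"
proof
  fix z :: "real \<times> real"
  obtain y q where z: "z = (y, q)" by force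
  obtain R where "R > 0" and R: "\<forall>x q. R < \<bar>x\<bar> \<longrightarrow> F (x, q) = 0"
    using strip_smooth_bound[OF F] by blast
  let ?c = "complex_of_real (1 / sqrt (2 * pi))"
  let ?hat = "\<lambda>p. LINT x|lborel. exp (\<i> * of_real (p * x)) * F (x, q)"
  have c2: "?c * ?c * (2 * of_real pi) = 1"
  proof -
    have "(1 / sqrt (2 * pi)) * (1 / sqrt (2 * pi)) * (2 * pi) = 1" by simp
    then have "complex_of_real ((1 / sqrt (2 * pi)) * (1 / sqrt (2 * pi)) * (2 * pi)) = 1" by (simp only: of_real_1)
    then show ?thesis by (simp only: of_real_mult of_real_numeral)
  qed
  have cont: "continuous_on UNIV (\<lambda>x. F (x, q))" by (rule strip_smooth_continuous_slice[OF F])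
  have "compact ((\<lambda>x. F (x, q)) ` {-R..R})"
    by (intro compact_continuous_image continuous_on_subset[OF cont]) auto
  from compact_imp_bounded[OF this] obtain M where "\<forall>x\<in>{-R..R}. norm (F (x, q)) \<le> M"
    by (auto simp: bounded_iff)
  then have bound: "norm (F (x, q)) \<le> max M 0" for x
    using R by (cases "R < \<bar>x\<bar>") (auto simp: abs_le_iff not_less le_max_iff_disj)
  have "integrable lborel (\<lambda>p. of_real (sqrt (2 * pi)) * fourier_p_inv F (p, q))"
    using fourier_p_inv_fourier_dom[OF F] by (intro integrable_mult_right) (simp add: fourier_dom_def)
  then have hat: "integrable lborel ?hat"
    by (simp add: fourier_p_inv_def mult.assoc[symmetric] of_real_mult[symmetric] del: of_real_mult)
  have "fourier_p (fourier_p_inv F) z = ?c * (LINT p|lborel. ?c * (exp (- \<i> * of_real (p * y)) * ?hat p))"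
    by (simp add: fourier_p_def fourier_p_inv_def z mult_ac)
  also have "\<dots> = ?c * (?c * (LINT p|lborel. exp (- \<i> * of_real (p * y)) * ?hat p))"
    by (simp only: integral_mult_right_zero)
  also have "(LINT p|lborel. exp (- \<i> * of_real (p * y)) * ?hat p) = 2 * of_real pi * F (y, q)"
    using compactly_supported_integrable(1)[OF cont, of R] R cont bound hat by (intro fourier_inversion) auto
  also have "?c * (?c * (2 * of_real pi * F (y, q))) = F z"
    using c2 by (simp only: mult.assoc[symmetric] z mult_1)
  finally show "fourier_p (fourier_p_inv F) z = F z" .
qed

section \<open>The Poisson powers of an affine symbol\<close>

lemma P_pow_0: "P_pow 0 u v z = u z * v z"
proof -
  have "multi_indices 0 = {[]}" by (auto simp: multi_indices_def)
  then show ?thesis by (simp add: P_pow_def partials_def)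
qed

lemma sum_multi_indices_Suc:
  "(\<Sum>is\<in>multi_indices (Suc k). f is) = (\<Sum>is\<in>multi_indices k. f (is @ [1]) + f (is @ [2]))"
proof -
  have eq: "multi_indices (Suc k) = (\<lambda>(is, i). is @ [i]) ` (multi_indices k \<times> {1, 2})"
  proof
    show "multi_indices (Suc k) \<subseteq> (\<lambda>(is, i). is @ [i]) ` (multi_indices k \<times> {1, 2})"
    proof
      fix js assume js: "js \<in> multi_indices (Suc k)"
      then have "js \<noteq> []" by (auto simp: multi_indices_def)
      then have d: "js = butlast js @ [last js]" by simp
      have "set js \<subseteq> {1, 2}" "length js = Suc k" using js by (auto simp: multi_indices_def)
      then have "butlast js \<in> multi_indices k" "last js \<in> {1, 2}"
        using last_in_set[OF \<open>js \<noteq> []\<close>] by (auto simp: multi_indices_def dest: in_set_butlastD)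
      then show "js \<in> (\<lambda>(is, i). is @ [i]) ` (multi_indices k \<times> {1, 2})"
        by (intro image_eqI[of _ _ "(butlast js, last js)"]) (simp_all add: d[symmetric])
    qed
  qed (auto simp: multi_indices_def)
  have inj: "inj_on (\<lambda>(is, i). is @ [i]) (multi_indices k \<times> {1, 2})"
    by (auto simp: inj_on_def)
  have "(\<Sum>is\<in>multi_indices (Suc k). f is) = (\<Sum>(is, i)\<in>multi_indices k \<times> {1, 2}. f (is @ [i]))"
    unfolding eq by (subst sum.reindex[OF inj]) (simp add: case_prod_beta)
  also have "\<dots> = (\<Sum>is\<in>multi_indices k. \<Sum>i\<in>{1, 2}. f (is @ [i]))"
    by (rule sum.cartesian_product[symmetric])
  finally show ?thesis by simp
qed

text \<open>Splitting off the last pair of indices leaves the bivector \<open>\<Lambda>\<close> with the pairs \<open>(1, 2)\<close> and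
  \<open>(2, 1)\<close> only. This recursion replaces the double sum over multi-indices in all that follows.\<close>

lemma P_pow_Suc:
  "P_pow (Suc k) u v z = P_pow k (partial 1 u) (partial 2 v) z - P_pow k (partial 2 u) (partial 1 v) z"
proof -
  have L: "(\<Prod>m<Suc k. Lambda ((is @ [i]) ! m) ((js @ [j]) ! m)) =
      (\<Prod>m<k. Lambda (is ! m) (js ! m)) * Lambda i j"
    if "is \<in> multi_indices k" "js \<in> multi_indices k" for "is" js i j
    using that by (simp add: multi_indices_def nth_append)
  have \<Lambda>: "Lambda 1 1 = 0" "Lambda 1 2 = 1" "Lambda 2 1 = - 1" "Lambda 2 2 = 0"
    by (simp_all add: Lambda_def)
  have "P_pow (Suc k) u v z = (\<Sum>is\<in>multi_indices k. \<Sum>js\<in>multi_indices k.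
      (\<Prod>m<k. Lambda (is ! m) (js ! m)) * partials is (partial 1 u) z * partials js (partial 2 v) z
      - (\<Prod>m<k. Lambda (is ! m) (js ! m)) * partials is (partial 2 u) z * partials js (partial 1 v) z)"
    unfolding P_pow_def sum_multi_indices_Suc sum.distrib[symmetric]
    by (intro sum.cong refl) (simp add: L \<Lambda> partials_snoc del: prod.lessThan_Suc One_nat_def)
  then show ?thesis
    by (simp add: P_pow_def sum_subtractf)
qed

lemma P_pow_zero_left: "P_pow k (\<lambda>z. 0) v z = 0"
proof (induction k arbitrary: v)
  case 0
  then show ?case by (simp add: P_pow_0)
next
  case (Suc k)
  have "partial 1 (\<lambda>z. 0) = (\<lambda>z. 0)" by (rule partial_1_eqI) simp
  moreover have "partial 2 (\<lambda>z. 0) = (\<lambda>z. 0)" by (rule partial_2_eqI) simp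
  ultimately show ?case by (simp only: P_pow_Suc Suc diff_zero)
qed

lemma times_ix_funpow_strip_smooth:
  "F \<in> strip_smooth \<Longrightarrow> (times_ix ^^ k) F \<in> strip_smooth"
  by (induction k) (auto intro: strip_smooth_times_ix)

lemma times_ix_funpow: "(times_ix ^^ k) F z = (\<i> * of_real (fst z)) ^ k * F z"
  by (induction k) (simp_all add: times_ix_def)

text \<open>\<open>\<alpha> k\<close> stands for the \<open>k\<close>-th derivative of \<open>\<alpha> 0\<close>. For a symbol without
  \<open>p\<close> every index pair must be \<open>(2, 1)\<close>. The starting order \<open>n\<close> is what the recursion shifts.\<close>

lemma P_pow_fourier_p_inv_q:
  fixes \<alpha> :: "nat \<Rightarrow> real \<Rightarrow> complex"
  assumes \<alpha>: "\<And>k q. (\<alpha> k has_vector_derivative \<alpha> (Suc k) q) (at q)"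
    and F: "F \<in> strip_smooth"
  shows "P_pow k (\<lambda>(p, q). \<alpha> n q) (fourier_p_inv F) (p, q) =
    (- 1) ^ k * \<alpha> (n + k) q * fourier_p_inv ((times_ix ^^ k) F) (p, q)"
  using F
proof (induction k arbitrary: n F)
  case 0
  then show ?case by (simp add: P_pow_0)
next
  case (Suc k)
  have "partial 1 (\<lambda>(p, q). \<alpha> n q) = (\<lambda>z. 0)" for n
    by (rule partial_1_eqI) simp
  moreover have "partial 2 (\<lambda>(p, q). \<alpha> n q) = (\<lambda>(p, q). \<alpha> (Suc n) q)" for n
    by (rule partial_2_eqI) (simp add: \<alpha>)
  ultimately show ?case
    using Suc.IH[OF strip_smooth_times_ix[OF Suc.prems], of "Suc n"] Suc.prems
    by (simp add: P_pow_Suc P_pow_zero_left partial_1_fourier_p_inv funpow_swap1 del: One_nat_def)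
qed

text \<open>The pair \<open>(1, 2)\<close> can occur at most once, in any of the \<open>k\<close> positions; since \<open>partial 2\<close>
  commutes with \<open>times_ix\<close>, all positions contribute equally. For \<open>k = 0\<close> the truncated \<open>k - 1\<close> is
  harmless because of the factor \<open>of_nat k\<close>.\<close>

lemma P_pow_fourier_p_inv_affine:
  fixes \<alpha> \<beta> :: "nat \<Rightarrow> real \<Rightarrow> complex"
  assumes \<alpha>: "\<And>k q. (\<alpha> k has_vector_derivative \<alpha> (Suc k) q) (at q)"
    and \<beta>: "\<And>k q. (\<beta> k has_vector_derivative \<beta> (Suc k) q) (at q)"
    and F: "F \<in> strip_smooth"
  shows "P_pow k (\<lambda>(p, q). \<alpha> n q * of_real p + \<beta> n q) (fourier_p_inv F) (p, q) =
    (- 1) ^ k * ((\<alpha> (n + k) q * of_real p + \<beta> (n + k) q) * fourier_p_inv ((times_ix ^^ k) F) (p, q)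
      - of_nat k * \<alpha> (n + k - 1) q * fourier_p_inv ((times_ix ^^ (k - 1)) (partial 2 F)) (p, q))"
  using F
proof (induction k arbitrary: n F)
  case 0
  then show ?case by (simp add: P_pow_0)
next
  case (Suc k)
  have d1: "partial 1 (\<lambda>(p, q). \<alpha> n q * of_real p + \<beta> n q) = (\<lambda>(p, q). \<alpha> n q)" for n
    by (rule partial_1_eqI) (auto intro!: derivative_eq_intros)
  have d2: "partial 2 (\<lambda>(p, q). \<alpha> n q * of_real p + \<beta> n q)
      = (\<lambda>(p, q). \<alpha> (Suc n) q * of_real p + \<beta> (Suc n) q)" for n
    by (rule partial_2_eqI)
      (auto intro!: has_vector_derivative_add has_vector_derivative_mult_left \<alpha> \<beta>)
  have F1: "times_ix F \<in> strip_smooth" and F2: "partial 2 F \<in> strip_smooth"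
    using Suc.prems by (auto intro: strip_smooth_times_ix strip_smooth_partial)
  have shift: "of_nat k * \<alpha> (Suc n + k - 1) q *
        fourier_p_inv ((times_ix ^^ (k - 1)) (partial 2 (times_ix F))) (p, q)
      = of_nat k * \<alpha> (n + k) q * fourier_p_inv ((times_ix ^^ k) (partial 2 F)) (p, q)"
    by (cases k) (simp_all add: partial_2_times_ix Suc.prems funpow_swap1)
  show ?case
    unfolding P_pow_Suc d1 d2 partial_1_fourier_p_inv[OF Suc.prems] partial_2_fourier_p_inv[OF Suc.prems]
      P_pow_fourier_p_inv_q[of \<alpha>, OF \<alpha> F2] Suc.IH[OF F1] shift
    by (simp add: funpow_swap1 algebra_simps)
qed

text \<open>The factor \<open>k\<close> cancels against \<open>k!\<close>, so that both parts of the Moyal series have the same shape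
  \<open>T\<close>, the second one with the index shifted by one and with \<open>partial 2 F\<close> in the place of \<open>F\<close>.\<close>

lemma moyal_term_fourier_p_inv_affine:
  fixes \<alpha> \<beta> :: "nat \<Rightarrow> real \<Rightarrow> complex"
  assumes \<alpha>: "\<And>k q. (\<alpha> k has_vector_derivative \<alpha> (Suc k) q) (at q)"
    and \<beta>: "\<And>k q. (\<beta> k has_vector_derivative \<beta> (Suc k) q) (at q)"
    and F: "F \<in> strip_smooth"
  defines "T \<equiv> \<lambda>c F p q k. c k / fact k * (- 1 / (2 * \<i>)) ^ k * fourier_p_inv ((times_ix ^^ k) F) (p, q)"
  shows "moyal_term (\<lambda>(p, q). \<alpha> 0 q * of_real p + \<beta> 0 q) (fourier_p_inv F) (p, q) k =
    T (\<lambda>k. \<alpha> k q * of_real p + \<beta> k q) F p q k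
    + (case k of 0 \<Rightarrow> 0 | Suc j \<Rightarrow> 1 / (2 * \<i>) * T (\<lambda>k. \<alpha> k q) (partial 2 F) p q j)"
proof -
  have m: "(1 / (2 * \<i>)) ^ k * (- 1) ^ k = (- 1 / (2 * \<i>)) ^ k" for k
    by (simp add: power_mult_distrib[symmetric])
  have "moyal_term (\<lambda>(p, q). \<alpha> 0 q * of_real p + \<beta> 0 q) (fourier_p_inv F) (p, q) k =
    1 / fact k * (- 1 / (2 * \<i>)) ^ k
      * ((\<alpha> k q * of_real p + \<beta> k q) * fourier_p_inv ((times_ix ^^ k) F) (p, q)
      - of_nat k * \<alpha> (k - 1) q * fourier_p_inv ((times_ix ^^ (k - 1)) (partial 2 F)) (p, q))"
    unfolding moyal_term_def P_pow_fourier_p_inv_affine[of \<alpha> \<beta>, OF \<alpha> \<beta> F] m[symmetric]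
    by (simp only: add_0 mult.assoc)
  also have "\<dots> = T (\<lambda>k. \<alpha> k q * of_real p + \<beta> k q) F p q k
    + (case k of 0 \<Rightarrow> 0 | Suc j \<Rightarrow> 1 / (2 * \<i>) * T (\<lambda>k. \<alpha> k q) (partial 2 F) p q j)"
  proof (cases k)
    case 0
    then show ?thesis by (simp add: T_def)
  next
    case (Suc j)
    have "1 / fact (Suc j) * of_nat (Suc j) = (1 / fact j :: complex)" by (simp add: field_simps del: of_nat_Suc)
    then have "1 / fact (Suc j) * (- 1 / (2 * \<i>)) ^ Suc j * (of_nat (Suc j) * a * b) = - (1 / (2 * \<i>) * (a / fact j * (- 1 / (2 * \<i>)) ^ j * b))" for a b :: complex
      by (simp add: field_simps del: of_nat_Suc fact_Suc)
    then show ?thesis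
      unfolding Suc T_def by (simp add: right_diff_distrib mult.assoc del: of_nat_Suc fact_Suc power_Suc funpow.simps)
  qed
  finally show ?thesis .
qed

section \<open>Summation of the Moyal series\<close>

lemma fourier_p_inv_slice_cong:
  assumes "\<And>x. F (x, q) = G (x, q)"
  shows "fourier_p_inv F (p, q) = fourier_p_inv G (p, q)"
  using assms by (simp add: fourier_p_inv_def)

text \<open>Since \<open>(- 1 / (2 i)) (i x) = - x / 2\<close>, the terms are Fourier integrals of the Taylor terms of \<open>C\<close>
  times \<open>F\<close>. On the support \<open>\<bar>x\<bar> \<le> R\<close> they are dominated by the exponential series of \<open>R / 2\<close>,
  which justifies summation under the integral sign.\<close>

lemma fourier_p_inv_taylor_sums:
  fixes c :: "nat \<Rightarrow> complex"
  assumes F: "F \<in> strip_smooth"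
    and M: "\<And>k. norm (c k) \<le> M"
    and C: "\<And>x. (\<lambda>k. c k / fact k * of_real (- x / 2) ^ k) sums C x"
  shows "(\<lambda>k. c k / fact k * (- 1 / (2 * \<i>)) ^ k * fourier_p_inv ((times_ix ^^ k) F) (p, q)) sums
    fourier_p_inv (\<lambda>z. C (fst z) * F z) (p, q)"
proof -
  let ?e = "\<lambda>x. exp (\<i> * of_real (p * x))"
  let ?c0 = "complex_of_real (1 / sqrt (2 * pi))"
  define f where "f k x = c k / fact k * of_real (- x / 2) ^ k * (?e x * F (x, q))" for k x
  obtain R where "R > 0" and R: "\<forall>x q. R < \<bar>x\<bar> \<longrightarrow> F (x, q) = 0"
    using strip_smooth_bound[OF F] by blast
  have "M \<ge> 0" using M[of 0] norm_ge_zero order_trans by blast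
  have f_eq: "f k x = c k / fact k * (- 1 / (2 * \<i>)) ^ k * (?e x * (times_ix ^^ k) F (x, q))" for k x
  proof -
    have "(- 1 / (2 * \<i>)) ^ k * (\<i> * of_real x) ^ k = complex_of_real (- x / 2) ^ k"
      by (simp add: power_mult_distrib[symmetric])
    then show ?thesis unfolding f_def times_ix_funpow fst_conv by (metis mult.assoc mult.left_commute)
  qed
  have f_int: "integrable lborel (f k)" for k
    unfolding f_eq by (intro integrable_mult_right fourier_slice_integrable times_ix_funpow_strip_smooth F)
  have f_norm: "norm (f k x) \<le> M * ((\<bar>x\<bar> / 2) ^ k /\<^sub>R fact k) * norm (F (x, q))" for k x
  proof -
    have "norm (f k x) = norm (c k) * (((\<bar>x\<bar> / 2) ^ k /\<^sub>R fact k) * norm (F (x, q)))"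
      by (simp add: f_def norm_mult norm_divide norm_power field_simps)
    also have "\<dots> \<le> M * (((\<bar>x\<bar> / 2) ^ k /\<^sub>R fact k) * norm (F (x, q)))"
      by (intro mult_right_mono M) simp
    finally show ?thesis by (simp add: mult_ac)
  qed
  have f_norm_R: "norm (f k x) \<le> M * ((R / 2) ^ k /\<^sub>R fact k) * norm (F (x, q))" for k x
  proof (cases "R < \<bar>x\<bar>")
    case True
    then show ?thesis using R by (simp add: f_def)
  next
    case False
    then have "(\<bar>x\<bar> / 2) ^ k \<le> (R / 2) ^ k" by (intro power_mono) auto
    then have "M * ((\<bar>x\<bar> / 2) ^ k /\<^sub>R fact k) * norm (F (x, q)) \<le> M * ((R / 2) ^ k /\<^sub>R fact k) * norm (F (x, q))"
      using \<open>M \<ge> 0\<close> by (intro mult_right_mono mult_left_mono scaleR_left_mono) auto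
    with f_norm[of k x] show ?thesis by linarith
  qed
  have F_int: "integrable lborel (\<lambda>x. norm (F (x, q)))"
    using integrable_norm[OF fourier_slice_integrable[OF F, of 0 q]] by simp
  have "(\<lambda>k. integral\<^sup>L lborel (f k)) sums (LINT x|lborel. (\<Sum>k. f k x))"
  proof (rule sums_integral[OF f_int])
    show "AE x in lborel. summable (\<lambda>k. norm (f k x))"
    proof (rule AE_I2)
      fix x :: real
      have "summable (\<lambda>k. M * ((\<bar>x\<bar> / 2) ^ k /\<^sub>R fact k) * norm (F (x, q)))"
        by (intro summable_mult2 summable_mult summable_exp_generic)
      then show "summable (\<lambda>k. norm (f k x))"
        by (rule summable_comparison_test') (use f_norm in simp)
    qed
    have "summable (\<lambda>k. M * ((R / 2) ^ k /\<^sub>R fact k) * (LINT x|lborel. norm (F (x, q))))"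
      by (intro summable_mult2 summable_mult summable_exp_generic)
    then show "summable (\<lambda>k. LINT x|lborel. norm (f k x))"
    proof (rule summable_comparison_test')
      fix k :: nat
      have "(LINT x|lborel. norm (f k x)) \<le> (LINT x|lborel. M * ((R / 2) ^ k /\<^sub>R fact k) * norm (F (x, q)))"
        by (intro integral_mono integrable_norm f_int integrable_mult_right F_int f_norm_R)
      then show "norm (LINT x|lborel. norm (f k x)) \<le> M * ((R / 2) ^ k /\<^sub>R fact k) * (LINT x|lborel. norm (F (x, q)))"
        by simp
    qed
  qed
  moreover have "(\<Sum>k. f k x) = ?e x * (C x * F (x, q))" for x
    using sums_mult2[OF C[of x], of "?e x * F (x, q)"] unfolding f_def
    by (simp add: sums_iff mult_ac)
  ultimately have "(\<lambda>k. ?c0 * integral\<^sup>L lborel (f k)) sums (?c0 * (LINT x|lborel. ?e x * (C x * F (x, q))))"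
    by (intro sums_mult) simp
  moreover have "?c0 * integral\<^sup>L lborel (f k) =
      c k / fact k * (- 1 / (2 * \<i>)) ^ k * fourier_p_inv ((times_ix ^^ k) F) (p, q)" for k
    unfolding f_eq integral_mult_right_zero fourier_p_inv_def prod.case by (simp only: mult_ac)
  ultimately show ?thesis
    by (simp add: fourier_p_inv_def)
qed

text \<open>The Moyal product shifts the argument of the symbol: summing the series evaluates \<open>\<alpha> 0\<close> and \<open>\<beta> 0\<close>
  at \<open>q - x / 2\<close> inside the Fourier integral. The hypotheses say that both functions have uniformly
  bounded derivatives and equal their Taylor series.\<close>

lemma moyal_fourier_p_inv_sums:
  fixes \<alpha> \<beta> :: "nat \<Rightarrow> real \<Rightarrow> complex"
  assumes \<alpha>: "\<And>k q. (\<alpha> k has_vector_derivative \<alpha> (Suc k) q) (at q)"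
    and \<beta>: "\<And>k q. (\<beta> k has_vector_derivative \<beta> (Suc k) q) (at q)"
    and \<alpha>M: "\<And>k q. norm (\<alpha> k q) \<le> M" and \<beta>M: "\<And>k q. norm (\<beta> k q) \<le> N"
    and \<alpha>T: "\<And>q h. (\<lambda>k. \<alpha> k q / fact k * of_real h ^ k) sums \<alpha> 0 (q + h)"
    and \<beta>T: "\<And>q h. (\<lambda>k. \<beta> k q / fact k * of_real h ^ k) sums \<beta> 0 (q + h)"
    and F: "F \<in> strip_smooth"
  shows "moyal_term (\<lambda>(p, q). \<alpha> 0 q * of_real p + \<beta> 0 q) (fourier_p_inv F) (p, q) sums
    (of_real p * fourier_p_inv (\<lambda>(x, q). \<alpha> 0 (q - x / 2) * F (x, q)) (p, q)
     + fourier_p_inv (\<lambda>(x, q). \<beta> 0 (q - x / 2) * F (x, q)) (p, q)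
     + 1 / (2 * \<i>) * fourier_p_inv (\<lambda>(x, q). \<alpha> 0 (q - x / 2) * partial 2 F (x, q)) (p, q))"
proof -
  define T where "T = (\<lambda>c F p q k. c k / fact k * (- 1 / (2 * \<i>)) ^ k * fourier_p_inv ((times_ix ^^ k) F) (p, q))"
  have T: "T (\<lambda>k. \<gamma> k q) G p q sums fourier_p_inv (\<lambda>(x, q). \<gamma> 0 (q - x / 2) * G (x, q)) (p, q)"
    if "G \<in> strip_smooth" "\<And>k q. norm (\<gamma> k q) \<le> B"
      "\<And>q h. (\<lambda>k. \<gamma> k q / fact k * of_real h ^ k) sums \<gamma> 0 (q + h)"
    for G B and \<gamma> :: "nat \<Rightarrow> real \<Rightarrow> complex"
  proof -
    have "(\<lambda>k. \<gamma> k q / fact k * of_real (- x / 2) ^ k) sums \<gamma> 0 (q - x / 2)" for x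
      using that(3)[of q "- x / 2"] by simp
    from fourier_p_inv_taylor_sums[OF that(1,2) this, of p q]
    show ?thesis
      unfolding T_def by (subst fourier_p_inv_slice_cong[where G = "\<lambda>z. \<gamma> 0 (q - fst z / 2) * G z"]) simp_all
  qed
  have F2: "partial 2 F \<in> strip_smooth" using F by (intro strip_smooth_partial) auto
  have 1: "(\<lambda>k. of_real p * T (\<lambda>k. \<alpha> k q) F p q k + T (\<lambda>k. \<beta> k q) F p q k) sums
      (of_real p * fourier_p_inv (\<lambda>(x, q). \<alpha> 0 (q - x / 2) * F (x, q)) (p, q)
        + fourier_p_inv (\<lambda>(x, q). \<beta> 0 (q - x / 2) * F (x, q)) (p, q))"
    by (intro sums_add sums_mult T[of _ \<alpha>, OF F \<alpha>M \<alpha>T] T[of _ \<beta>, OF F \<beta>M \<beta>T])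
  have "(\<lambda>j. 1 / (2 * \<i>) * T (\<lambda>k. \<alpha> k q) (partial 2 F) p q j) sums
      (1 / (2 * \<i>) * fourier_p_inv (\<lambda>(x, q). \<alpha> 0 (q - x / 2) * partial 2 F (x, q)) (p, q))"
    by (intro sums_mult T[of _ \<alpha>, OF F2 \<alpha>M \<alpha>T])
  then have 2: "(\<lambda>k. case k of 0 \<Rightarrow> 0 | Suc j \<Rightarrow> 1 / (2 * \<i>) * T (\<lambda>k. \<alpha> k q) (partial 2 F) p q j) sums
      (1 / (2 * \<i>) * fourier_p_inv (\<lambda>(x, q). \<alpha> 0 (q - x / 2) * partial 2 F (x, q)) (p, q))"
    using sums_Suc[of "\<lambda>k. case k of 0 \<Rightarrow> 0 | Suc j \<Rightarrow> 1 / (2 * \<i>) * T (\<lambda>k. \<alpha> k q) (partial 2 F) p q j"] by simp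
  have "moyal_term (\<lambda>(p, q). \<alpha> 0 q * of_real p + \<beta> 0 q) (fourier_p_inv F) (p, q) =
     (\<lambda>k. of_real p * T (\<lambda>k. \<alpha> k q) F p q k + T (\<lambda>k. \<beta> k q) F p q k
     + (case k of 0 \<Rightarrow> 0 | Suc j \<Rightarrow> 1 / (2 * \<i>) * T (\<lambda>k. \<alpha> k q) (partial 2 F) p q j))"
  proof
    fix k
    have "T (\<lambda>k. \<alpha> k q * of_real p + \<beta> k q) F p q k = of_real p * T (\<lambda>k. \<alpha> k q) F p q k + T (\<lambda>k. \<beta> k q) F p q k"
      unfolding T_def by (simp add: add_divide_distrib algebra_simps)
    then show "moyal_term (\<lambda>(p, q). \<alpha> 0 q * of_real p + \<beta> 0 q) (fourier_p_inv F) (p, q) k =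
        of_real p * T (\<lambda>k. \<alpha> k q) F p q k + T (\<lambda>k. \<beta> k q) F p q k
        + (case k of 0 \<Rightarrow> 0 | Suc j \<Rightarrow> 1 / (2 * \<i>) * T (\<lambda>k. \<alpha> k q) (partial 2 F) p q j)"
      using moyal_term_fourier_p_inv_affine[of \<alpha> \<beta>, OF \<alpha> \<beta> F] by (simp only: T_def)
  qed
  with sums_add[OF 1 2] show ?thesis by simp
qed

section \<open>Trigonometric symbols\<close>

text \<open>The \<open>k\<close>-th derivative of \<open>c + u exp (i q) + v exp (- i q)\<close>. Exponentials rather than sine and
  cosine make the derivative, its bound and the Taylor series uniform in \<open>k\<close>; the constant is the exception, present for
  \<open>k = 0\<close> only.\<close>

definition trig :: "complex \<Rightarrow> complex \<Rightarrow> complex \<Rightarrow> nat \<Rightarrow> real \<Rightarrow> complex" where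
  "trig c u v k q = (if k = 0 then c else 0) + u * \<i> ^ k * exp (\<i> * of_real q) + v * (- \<i>) ^ k * exp (- \<i> * of_real q)"

lemma trig_has_vector_derivative: "(trig c u v k has_vector_derivative trig c u v (Suc k) q) (at q)"
proof -
  note d = exp_affine_has_vector_derivative[of 0 _ q UNIV, simplified]
  have "((\<lambda>q. (if k = 0 then c else 0) + u * \<i> ^ k * exp (\<i> * of_real q) + v * (- \<i>) ^ k * exp (- \<i> * of_real q))
      has_vector_derivative (0 + u * \<i> ^ k * (\<i> * exp (\<i> * of_real q)) + v * (- \<i>) ^ k * (- \<i> * exp (- \<i> * of_real q)))) (at q)"
    by (intro has_vector_derivative_add has_vector_derivative_const has_vector_derivative_mult_right d)
  then show ?thesis
    by (simp add: trig_def[abs_def] mult_ac)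
qed

lemma norm_trig_le: "norm (trig c u v k q) \<le> norm c + norm u + norm v"
proof -
  have "norm (exp (\<i> * of_real q)) = 1" "norm (exp (- \<i> * of_real q)) = 1" by simp_all
  then have "norm (u * \<i> ^ k * exp (\<i> * of_real q)) = norm u" "norm (v * (- \<i>) ^ k * exp (- \<i> * of_real q)) = norm v"
    by (simp_all only: norm_mult norm_power norm_minus_cancel norm_ii power_one mult_1_right)
  moreover have "norm (if k = 0 then c else 0) \<le> norm c" by simp
  ultimately show ?thesis
    unfolding trig_def
    using norm_triangle_ineq[of "(if k = 0 then c else 0) + u * \<i> ^ k * exp (\<i> * of_real q)" "v * (- \<i>) ^ k * exp (- \<i> * of_real q)"]
      norm_triangle_ineq[of "if k = 0 then c else 0" "u * \<i> ^ k * exp (\<i> * of_real q)"]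
    by linarith
qed

lemma trig_taylor: "(\<lambda>k. trig c u v k q / fact k * of_real h ^ k) sums trig c u v 0 (q + h)"
proof -
  have e: "(\<lambda>k. a * exp (w * of_real q) * ((w * of_real h) ^ k /\<^sub>R fact k)) sums (a * exp (w * of_real (q + h)))" for a w :: complex
    using sums_mult[OF exp_converges[of "w * of_real h"], of "a * exp (w * of_real q)"]
    by (simp add: exp_add distrib_left mult_ac)
  have c: "(\<lambda>k. if k = 0 then c else 0) sums c" using sums_single[of 0 "\<lambda>_. c"] by simp
  have "trig c u v k q / fact k * of_real h ^ k = (if k = 0 then c else 0)
      + u * exp (\<i> * of_real q) * ((\<i> * of_real h) ^ k /\<^sub>R fact k)
      + v * exp (- \<i> * of_real q) * ((- \<i> * of_real h) ^ k /\<^sub>R fact k)" for k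
    by (simp only: trig_def scaleR_conv_of_real of_real_inverse of_real_fact power_mult_distrib)
      (auto simp: field_simps)
  with sums_add[OF sums_add[OF c e[of u "\<i>"]] e[of v "- \<i>"]]
  show ?thesis by (simp add: trig_def)
qed

lemma smooth_trig_skew: "smooth (\<lambda>(x, q). trig c u v 0 (q - x / 2))"
  using smooth_add[OF smooth_add[OF smooth_exp_skew[of c 0] smooth_exp_skew[of u "\<i>"]] smooth_exp_skew[of v "- \<i>"]]
  by (simp add: trig_def case_prod_unfold)

lemma trig_skew_has_vector_derivative:
  "((\<lambda>x. trig c u v 0 (q - x / 2)) has_vector_derivative - trig c u v 1 (q - x / 2) / 2) (at x)"
proof -
  have "((\<lambda>x. q - x / 2) has_vector_derivative (- 1 / 2)) (at x)"
    by (auto intro!: derivative_eq_intros)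
  from vector_diff_chain_at[OF this trig_has_vector_derivative[of c u v 0]]
  show ?thesis by (simp add: o_def scaleR_conv_of_real)
qed

lemma trig_real:
  "trig (of_real c) (of_real a - \<i> * of_real b) (of_real a + \<i> * of_real b) 0 q = of_real (2 * a * cos q + 2 * b * sin q + c)"
  "trig (of_real c) (of_real a - \<i> * of_real b) (of_real a + \<i> * of_real b) 1 q = of_real (- 2 * a * sin q + 2 * b * cos q)"
proof -
  have e: "exp (\<i> * of_real q) = of_real (cos q) + \<i> * of_real (sin q)"
    "exp (- \<i> * of_real q) = of_real (cos q) - \<i> * of_real (sin q)"
    using cis_conv_exp[of q] cis_conv_exp[of "- q"] by (simp_all add: complex_eq_iff)
  show "trig (of_real c) (of_real a - \<i> * of_real b) (of_real a + \<i> * of_real b) 0 q = of_real (2 * a * cos q + 2 * b * sin q + c)"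
    "trig (of_real c) (of_real a - \<i> * of_real b) (of_real a + \<i> * of_real b) 1 q = of_real (- 2 * a * sin q + 2 * b * cos q)"
    unfolding trig_def e by (simp_all add: complex_eq_iff algebra_simps)
qed

section \<open>The conjugated operator\<close>

theorem theorem4p4:
  fixes lam a1 b1 c1 :: real
    and A :: "real^2^2"
    and f :: "real \<times> real \<Rightarrow> complex"
  assumes "lam \<noteq> 0"
    and "A \<in> sl2"
    and "A = a1 *\<^sub>R sl2_X + b1 *\<^sub>R sl2_H + c1 *\<^sub>R sl2_Y"
    and "f \<in> Cc_infinity"
  shows "fourier_p_inv f \<in> fourier_dom \<and> fourier_p (fourier_p_inv f) = f
    \<and> fourier_p_inv f \<in> l_dom lam A
    \<and> l_op lam A (fourier_p_inv f) \<in> fourier_dom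
    \<and> (\<forall>x q. let s = q - x / 2 in
         l_hat lam A f (x, q) =
           complex_of_real (a1 * cos s + b1 * sin s - c1) * partial_s f (x, q)
           + complex_of_real (- a1 * sin s + b1 * cos s) * (2 * complex_of_real lam * \<i> + 1) * f (x, q))"
proof -
  have f: "f \<in> strip_smooth" using assms(4) Cc_infinity_subset_strip_smooth by blast
  have f2: "partial 2 f \<in> strip_smooth" using f by (intro strip_smooth_partial) auto
  \<comment> \<open>The coefficients make \<open>\<alpha> 0 = 2 a\<^sub>1 cos + 2 b\<^sub>1 sin - 2 c\<^sub>1\<close> and
  \<open>\<beta> 0 = \<lambda> (2 b\<^sub>1 cos - 2 a\<^sub>1 sin)\<close>, the coefficients of the symbol.\<close>
  define \<alpha> where "\<alpha> = trig (of_real (- 2 * c1)) (of_real a1 - \<i> * of_real b1) (of_real a1 + \<i> * of_real b1)"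
  define \<beta> where "\<beta> = trig (of_real 0) (of_real (lam * b1) - \<i> * of_real (- lam * a1)) (of_real (lam * b1) + \<i> * of_real (- lam * a1))"
  define \<alpha>s where "\<alpha>s = (\<lambda>(x, q). \<alpha> 0 (q - x / 2))"
  define \<beta>s where "\<beta>s = (\<lambda>(x, q). \<beta> 0 (q - x / 2))"
  have u: "(\<lambda>z. complex_of_real (tilde lam A z)) = (\<lambda>(p, q). \<alpha> 0 q * of_real p + \<beta> 0 q)"
  proof -
    have "complex_of_real (tilde lam A (p, q)) = \<alpha> 0 q * of_real p + \<beta> 0 q" for p q
      unfolding assms(3) tilde_lincomb \<alpha>_def \<beta>_def trig_real by (simp add: algebra_simps)
    then show ?thesis by auto
  qed
  have \<alpha>f: "(\<lambda>z. \<alpha>s z * f z) \<in> strip_smooth" and \<beta>f: "(\<lambda>z. \<beta>s z * f z) \<in> strip_smooth"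
    and \<alpha>f2: "(\<lambda>z. \<alpha>s z * partial 2 f z) \<in> strip_smooth"
    unfolding \<alpha>s_def \<beta>s_def \<alpha>_def \<beta>_def by (intro strip_smooth_mult smooth_trig_skew f f2)+
  have sums: "moyal_term (\<lambda>z. complex_of_real (tilde lam A z)) (fourier_p_inv f) (p, q) sums
    (of_real p * fourier_p_inv (\<lambda>z. \<alpha>s z * f z) (p, q)
     + fourier_p_inv (\<lambda>z. \<beta>s z * f z) (p, q)
     + 1 / (2 * \<i>) * fourier_p_inv (\<lambda>z. \<alpha>s z * partial 2 f z) (p, q))" for p q
  proof -
    have "(\<alpha> k has_vector_derivative \<alpha> (Suc k) q) (at q)" "(\<beta> k has_vector_derivative \<beta> (Suc k) q) (at q)" for k q
      unfolding \<alpha>_def \<beta>_def by (rule trig_has_vector_derivative)+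
    moreover obtain M N where "\<And>k q. norm (\<alpha> k q) \<le> M" "\<And>k q. norm (\<beta> k q) \<le> N"
      unfolding \<alpha>_def \<beta>_def using norm_trig_le by blast
    moreover have "(\<lambda>k. \<alpha> k q / fact k * of_real h ^ k) sums \<alpha> 0 (q + h)"
      "(\<lambda>k. \<beta> k q / fact k * of_real h ^ k) sums \<beta> 0 (q + h)" for q h
      unfolding \<alpha>_def \<beta>_def by (rule trig_taylor)+
    ultimately show ?thesis
      using moyal_fourier_p_inv_sums[of \<alpha> \<beta> M N f p q] f
      unfolding u \<alpha>s_def \<beta>s_def by (simp add: case_prod_unfold)
  qed
  \<comment> \<open>The three summands come from \<open>i p G(\<alpha>s f) = - G(\<partial>\<^sub>x(\<alpha>s f))\<close>, from \<open>i \<beta>s f\<close>, and from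
  \<open>i / (2 i) = 1 / 2\<close> times \<open>\<alpha>s \<partial>\<^sub>q f\<close>.\<close>
  define h where "h = (\<lambda>z. - 1 * partial 1 (\<lambda>z. \<alpha>s z * f z) z + (\<i> * (\<beta>s z * f z) + 1 / 2 * (\<alpha>s z * partial 2 f z)))"
  have d: "partial 1 (\<lambda>z. \<alpha>s z * f z) \<in> strip_smooth"
    using \<alpha>f by (intro strip_smooth_partial) auto
  have h: "h \<in> strip_smooth"
    unfolding h_def by (intro strip_smooth_add strip_smooth_cmult d \<beta>f \<alpha>f2)
  have l: "l_op lam A (fourier_p_inv f) = fourier_p_inv h"
  proof
    fix z :: "real \<times> real"
    obtain p q where z: "z = (p, q)" by force
    have "fourier_p_inv h z = - fourier_p_inv (partial 1 (\<lambda>z. \<alpha>s z * f z)) z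
        + (\<i> * fourier_p_inv (\<lambda>z. \<beta>s z * f z) z + 1 / 2 * fourier_p_inv (\<lambda>z. \<alpha>s z * partial 2 f z) z)"
      unfolding h_def
      by (simp only: fourier_p_inv_add fourier_p_inv_cmult strip_smooth_add strip_smooth_cmult d \<beta>f \<alpha>f2) simp
    then show "l_op lam A (fourier_p_inv f) z = fourier_p_inv h z"
      unfolding l_op_def z sums_unique[OF sums, symmetric] fourier_p_inv_partial_1[OF \<alpha>f]
      by (simp add: algebra_simps)
  qed
  have h_eq: "h (x, q) = complex_of_real (a1 * cos (q - x / 2) + b1 * sin (q - x / 2) - c1) * partial_s f (x, q)
      + complex_of_real (- a1 * sin (q - x / 2) + b1 * cos (q - x / 2)) * (2 * complex_of_real lam * \<i> + 1) * f (x, q)" for x q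
  proof -
    have "partial 1 (\<lambda>z. \<alpha>s z * f z) =
        (\<lambda>(x, q). \<alpha> 0 (q - x / 2) * partial 1 f (x, q) + - \<alpha> 1 (q - x / 2) / 2 * f (x, q))"
    proof (rule partial_1_eqI)
      fix x q
      show "((\<lambda>x. \<alpha>s (x, q) * f (x, q)) has_vector_derivative
        (case (x, q) of (x, q) \<Rightarrow> \<alpha> 0 (q - x / 2) * partial 1 f (x, q) + - \<alpha> 1 (q - x / 2) / 2 * f (x, q))) (at x)"
        unfolding \<alpha>s_def \<alpha>_def prod.case
        by (rule has_vector_derivative_mult[OF trig_skew_has_vector_derivative smooth_has_partial(1)[OF strip_smooth_smooth[OF f]]])
    qed
    then show ?thesis
      unfolding h_def \<alpha>s_def \<beta>s_def \<alpha>_def \<beta>_def prod.case trig_real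
      by (simp add: partial_s_def field_simps)
  qed
  have "fourier_p_inv f \<in> l_dom lam A"
    using sums smooth_fourier_p_inv[OF f] by (auto simp: l_dom_def sums_iff)
  moreover have "l_hat lam A f = h"
    by (simp add: l_hat_def l fourier_p_fourier_p_inv h)
  ultimately show ?thesis
    using f h by (simp only: Let_def h_eq l fourier_p_inv_fourier_dom fourier_p_fourier_p_inv) simp
qed

end
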